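(* (i) Let $S\equiv\pm\{1, 4, 7, 9, 10, 11, 12, 13, 14, 15, 17, 23\}\pmod{48}$ and $T\equiv\pm\{1, 3, 7, 8, 10, 11, 12, 13, 17, 21, 22, 23\}\pmod{48}$. Then $p(S,n)=p(T,n-1)$ for all $n\geq 1$. (ii) Let $S\equiv\pm\{2, 5, 7, 8, 9, 11, 12, 13, 14, 15, 17, 19\}\pmod{48}$ and $T\equiv\pm\{2, 3, 5, 7, 11, 12, 13, 17, 19, 20, 21, 22\}\pmod{48}$. Then $p(S,n)=p(T,n-2)$ for all $n\geq 2$. (iii) Let $S\equiv\pm\{1, 3, 5, 7, 8, 10, 12, 17, 19, 21, 22, 23\}\pmod{48}$ and $T\equiv\pm\{1, 2, 5, 7, 9, 12, 15, 17, 19, 20, 22, 23\}\pmod{48}$. Then $p(S,n)=p(T,n-1)$ for all $n\geq 1$. (iv) Let $S\equiv\pm\{1, 2, 5, 8, 9, 11, 12, 13, 14, 15, 19, 23\}\pmod{48}$ and $T\equiv\pm\{1, 3, 4, 5, 10, 11, 12, 13, 14, 19, 21, 23\}\pmod{48}$. Then $p(S,n)=p(T,n)$ for all integers $n\ge0$ with $n\neq 2$.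
   Context: For a set $S$ of positive integers and an integer $n\ge 0$, $p(S,n)$ denotes the number of partitions of $n$ into parts belonging to $S$ (so $p(S,0)=1$). The notation $S\equiv\pm\{r_1,\dots,r_k\}\pmod M$ means that $S$ is the set of all positive integers $n$ such that $n\equiv r_i$ or $n\equiv -r_i\pmod M$ for some $i$. *)

theory Defs
  imports "HOL-Library.Multiset" "HOL-Number_Theory.Cong"
begin

definition partitions_into :: "nat set \<Rightarrow> nat \<Rightarrow> nat multiset set" where
  "partitions_into S n = {P. set_mset P \<subseteq> S \<and> sum_mset P = n}"

(* Meaningful only for sets S of positive integers: if 0 is in S, the set of multisets is infinite
   or empty and the cardinality is 0. *)
definition num_partitions :: "nat set \<Rightarrow> nat \<Rightarrow> nat" where
  "num_partitions S n = card (partitions_into S n)"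

definition pm_residues :: "int set \<Rightarrow> int \<Rightarrow> nat set" where
  "pm_residues R M = {n. n > 0 \<and> (\<exists>r\<in>R. [int n = r] (mod M) \<or> [int n = - r] (mod M))}"

lemma zero_notin_pm_residues: "0 \<notin> pm_residues R M"
  by (simp add: pm_residues_def)

lemma finite_partitions_into:
  assumes "0 \<notin> S"
  shows "finite (partitions_into S n)"
proof -
  have size_le: "size P \<le> sum_mset P" if "0 \<notin># P" for P :: "nat multiset"
    using that by (induction P) auto
  have "partitions_into S n \<subseteq> mset ` {xs. set xs \<subseteq> {..n} \<and> length xs \<le> n}"
  proof
    fix P assume "P \<in> partitions_into S n"
    then have P: "set_mset P \<subseteq> S" "sum_mset P = n"
      by (auto simp: partitions_into_def)
    obtain xs where xs: "P = mset xs"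
      by (metis ex_mset)
    have "length xs \<le> n"
      using size_le[of P] P assms xs by auto
    moreover have "set xs \<subseteq> {..n}"
      using P xs by (auto simp: sum_mset_sum_list intro: member_le_sum_list)
    ultimately show "P \<in> mset ` {xs. set xs \<subseteq> {..n} \<and> length xs \<le> n}"
      using xs by auto
  qed
  then show ?thesis
    by (rule finite_subset) (intro finite_imageI finite_lists_length_le, simp)
qed

lemma num_partitions_0:
  assumes "0 \<notin> S"
  shows "num_partitions S 0 = 1"
proof -
  have "partitions_into S 0 = {{#}}"
  proof (intro equalityI subsetI)
    fix P assume "P \<in> partitions_into S 0"
    then have "set_mset P \<subseteq> S" "\<forall>x\<in>#P. x = 0"
      by (auto simp: partitions_into_def)
    then show "P \<in> {{#}}"
      using assms by (cases P) auto
  qed (simp add: partitions_into_def)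
  then show ?thesis
    by (simp add: num_partitions_def)
qed

end

theory Submission
  imports Defs "HOL-Analysis.Analysis"
begin

text \<open>
  The generating function of each set of parts is a reciprocal product of theta functions
  \<open>\<theta>(a) = (q\<^sup>a; q\<^sup>4\<^sup>8) (q\<^sup>4\<^sup>8 / q\<^sup>a; q\<^sup>4\<^sup>8)\<close>, so each part of the theorem is an identity
  \<open>1 / \<Prod>\<^sub>S \<theta>(a) - q\<^sup>b / \<Prod>\<^sub>T \<theta>(a) = q\<^sup>c\<close> for \<open>0 < q < 1\<close>.
  By the Jacobi triple product, \<open>\<theta>(x y) \<theta>(x / y) / x\<close> is a two-by-two determinant in \<open>x\<close> and \<open>y\<close>, and the
  Pluecker relation between such determinants is Weierstrass' three-term relation.
  The first identity is a combination of three instances of that relation, two for the nome \<open>q\<^sup>2\<^sup>4\<close> and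
  one for \<open>q\<^sup>4\<^sup>8\<close>, linked by the duplication formulas
  \<open>\<theta>(z; p) = \<theta>(z; p\<^sup>2) \<theta>(p z; p\<^sup>2)\<close> and \<open>\<theta>(z; p) \<theta>(- z; p) = \<theta>(z\<^sup>2; p\<^sup>2)\<close>; the other three identities
  arise from it by multiplying all residues by 5, 17 and 13.
\<close>

subsection \<open>Theta functions as infinite products\<close>

text \<open>Over a common denominator the first identity equates a product of 16 theta values of
  nome \<open>q^48\<close> with a difference of two products of 4. Three-term relations for one nome
  are homogeneous of degree 4, so those for \<open>q^48\<close> alone cannot yield it. The
  duplication formulas supply the missing degrees: in terms of nome \<open>q^48\<close>, a value of
  nome \<open>q^24\<close> has degree 2 at \<open>q^a\<close> and degree -1 at \<open>- q^a\<close>.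
  A relation with four factors of the first kind on one side and four of the second kind in each
  term of the other compares degree 8 with degree -4, exactly the required gap of 12. Multiplying
  residues is possible because the normalised relations contain no powers of \<open>q\<close>: they
  use only sums and differences of arguments, parity and (anti)periodicity. The powers of
  \<open>q\<close> return when the normalisation is undone, and they are the shifts \<open>b\<close>
  and the exceptional exponents \<open>c\<close> of the four parts. Real \<open>q\<close> in the
  unit interval suffices, since a power series is determined by its sums there, and it allows
  arbitrary real exponents, in particular half-integers.\<close>

definition qpoch :: "real \<Rightarrow> real \<Rightarrow> real" where
  "qpoch p z = (\<Prod>n. 1 - z * p ^ n)"

definition theta :: "real \<Rightarrow> real \<Rightarrow> real" where
  "theta p z = qpoch p z * qpoch p (p / z)"

lemma convergent_prod_qpoch:
  fixes p z :: real
  assumes "0 < p" "p < 1"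
  shows "convergent_prod (\<lambda>n. 1 - z * p ^ n)"
proof (rule abs_convergent_prod_imp_convergent_prod)
  have "summable (\<lambda>n. \<bar>z\<bar> * p ^ n)"
    using assms by (intro summable_mult summable_geometric) auto
  then show "abs_convergent_prod (\<lambda>n. 1 - z * p ^ n)"
    using assms by (simp add: abs_convergent_prod_conv_summable abs_mult)
qed

lemma tendsto_qpoch:
  assumes "0 < p" "p < 1"
  shows "(\<lambda>n. \<Prod>i<n. 1 - z * p ^ i) \<longlonglongrightarrow> qpoch p z"
  unfolding qpoch_def
  by (rule has_prod_imp_tendsto') (use convergent_prod_qpoch[OF assms] in auto)

lemma qpoch_nonzero:
  assumes "0 < p" "p < 1" "\<And>n. z * p ^ n \<noteq> 1"
  shows "qpoch p z \<noteq> 0"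
  unfolding qpoch_def
  using assms by (intro prodinf_nonzero convergent_prod_qpoch) auto

lemma qpoch_shift:
  assumes "0 < p" "p < 1"
  shows "qpoch p z = (1 - z) * qpoch p (p * z)"
proof (rule LIMSEQ_unique)
  show "(\<lambda>n. \<Prod>i<Suc n. 1 - z * p ^ i) \<longlonglongrightarrow> qpoch p z"
    by (rule LIMSEQ_Suc[OF tendsto_qpoch[OF assms]])
  have "(\<Prod>i<Suc n. 1 - z * p ^ i) = (1 - z) * (\<Prod>i<n. 1 - p * z * p ^ i)" for n
    unfolding prod.lessThan_Suc_shift by (simp add: mult_ac)
  then show "(\<lambda>n. \<Prod>i<Suc n. 1 - z * p ^ i) \<longlonglongrightarrow> (1 - z) * qpoch p (p * z)"
    by (simp only:) (intro tendsto_mult tendsto_const tendsto_qpoch assms)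
qed

lemma qpoch_minus:
  assumes "0 < p" "p < 1"
  shows "qpoch p z * qpoch p (- z) = qpoch (p\<^sup>2) (z\<^sup>2)"
proof -
  have "qpoch p z * qpoch p (- z) = (\<Prod>n. (1 - z * p ^ n) * (1 - (- z) * p ^ n))"
    unfolding qpoch_def by (intro prodinf_mult convergent_prod_qpoch assms)
  also have "(\<lambda>n. (1 - z * p ^ n) * (1 - (- z) * p ^ n)) = (\<lambda>n. 1 - z\<^sup>2 * (p\<^sup>2) ^ n)"
    by (auto simp: algebra_simps power2_eq_square power_mult_distrib)
  finally show ?thesis
    unfolding qpoch_def .
qed

lemma qpoch_split:
  assumes "0 < p" "p < 1"
  shows "qpoch p z = qpoch (p\<^sup>2) z * qpoch (p\<^sup>2) (p * z)"
proof (rule LIMSEQ_unique)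
  have p2: "0 < p\<^sup>2" "p\<^sup>2 < 1"
    using assms by (auto simp: power_less_one_iff abs_square_less_1)
  have "strict_mono (\<lambda>n::nat. 2 * n)"
    by (auto simp: strict_mono_def)
  from LIMSEQ_subseq_LIMSEQ[OF tendsto_qpoch[OF assms] this]
  show "(\<lambda>n. \<Prod>i<2 * n. 1 - z * p ^ i) \<longlonglongrightarrow> qpoch p z"
    by (simp add: o_def)
  have "(\<Prod>i<2 * n. 1 - z * p ^ i)
      = (\<Prod>i<n. 1 - z * (p\<^sup>2) ^ i) * (\<Prod>i<n. 1 - p * z * (p\<^sup>2) ^ i)" for n
    by (induction n) (simp_all flip: power_mult add: mult_ac)
  then show "(\<lambda>n. \<Prod>i<2 * n. 1 - z * p ^ i) \<longlonglongrightarrow> qpoch (p\<^sup>2) z * qpoch (p\<^sup>2) (p * z)"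
    by (simp only:) (intro tendsto_mult tendsto_qpoch p2)
qed

text \<open>The shift removes the factor \<open>1 - z\<close> from one product and adds
  \<open>1 - 1 / z\<close> to the other; the quotient of the two is \<open>- 1 / z\<close>.\<close>

lemma theta_shift:
  assumes "0 < p" "p < 1" "z \<noteq> 0"
  shows "theta p (p * z) = - theta p z / z"
proof -
  have a: "qpoch p z = (1 - z) * qpoch p (p * z)"
    by (rule qpoch_shift[OF assms(1,2)])
  have b: "qpoch p (1 / z) = (1 - 1 / z) * qpoch p (p / z)"
    using qpoch_shift[OF assms(1,2), of "1 / z"] by simp
  have "theta p (p * z) = qpoch p (p * z) * qpoch p (1 / z)"
    using assms by (simp add: theta_def)
  also have "\<dots> = - theta p z / z"
    unfolding theta_def a b using assms by (simp add: field_simps)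
  finally show ?thesis .
qed

text \<open>Exchanging the two products shows that \<open>1 / z\<close> and \<open>p * z\<close>
  give the same value, so the computation is that of the shift.\<close>

lemma theta_inverse:
  assumes "0 < p" "p < 1" "z \<noteq> 0"
  shows "theta p (1 / z) = - theta p z / z"
proof -
  have a: "qpoch p z = (1 - z) * qpoch p (p * z)"
    by (rule qpoch_shift[OF assms(1,2)])
  have b: "qpoch p (1 / z) = (1 - 1 / z) * qpoch p (p / z)"
    using qpoch_shift[OF assms(1,2), of "1 / z"] by simp
  have "theta p (1 / z) = qpoch p (p * z) * qpoch p (1 / z)"
    using assms by (simp add: theta_def)
  also have "\<dots> = - theta p z / z"
    unfolding theta_def a b using assms by (simp add: field_simps)
  finally show ?thesis .
qed

lemma theta_nonzero:
  assumes "0 < p" "p < 1" "z \<noteq> 0" "\<And>n. z * p ^ n \<noteq> 1" "\<And>n. p ^ Suc n \<noteq> z"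
  shows "theta p z \<noteq> 0"
proof -
  have "p / z * p ^ n \<noteq> 1" for n
    using assms(3) assms(5)[of n] by (simp add: field_simps)
  then show ?thesis
    unfolding theta_def using assms qpoch_nonzero[of p z] qpoch_nonzero[of p "p / z"] by simp
qed

lemma theta_minus:
  assumes "0 < p" "p < 1"
  shows "theta p z * theta p (- z) = theta (p\<^sup>2) (z\<^sup>2)"
  using qpoch_minus[OF assms, of z] qpoch_minus[OF assms, of "p / z"]
  by (simp add: theta_def power_divide mult_ac)

text \<open>Splitting both products by the parity of the exponent gives four, which pair up
  crosswise: \<open>z\<close> with \<open>p\<^sup>2 / z\<close>, and \<open>p * z\<close> with
  \<open>p / z\<close>.\<close>

lemma theta_split:
  assumes "0 < p" "p < 1"
  shows "theta p z = theta (p\<^sup>2) z * theta (p\<^sup>2) (p * z)"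
  using qpoch_split[OF assms, of z] qpoch_split[OF assms, of "p / z"]  assms
  by (simp add: theta_def power2_eq_square mult_ac)

subsection \<open>The Jacobi triple product\<close>

definition qfact :: "real \<Rightarrow> nat \<Rightarrow> real" where
  "qfact p n = (\<Prod>i<n. 1 - p ^ Suc i)"

text \<open>The Gaussian binomial coefficient. The value 0 above \<open>n\<close> lets Pascal's rule
  hold at \<open>j = n\<close> as well.\<close>

definition qbinom :: "real \<Rightarrow> nat \<Rightarrow> nat \<Rightarrow> real" where
  "qbinom p n j = (if j \<le> n then qfact p n / (qfact p j * qfact p (n - j)) else 0)"

lemma qfact_0 [simp]: "qfact p 0 = 1"
  by (simp add: qfact_def)

lemma qfact_pos:
  assumes "0 < p" "p < 1"
  shows "qfact p n > 0"
  unfolding qfact_def using assms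
  by (intro prod_pos) (simp del: power_Suc add: power_less_one_iff)

lemma qfact_le_1:
  assumes "0 < p" "p < 1"
  shows "qfact p n \<le> 1"
  unfolding qfact_def using assms
  by (intro prod_le_1) (auto simp del: power_Suc simp: power_le_one)

lemma tendsto_qfact:
  assumes "0 < p" "p < 1"
  shows "qfact p \<longlonglongrightarrow> qpoch p p"
  using tendsto_qpoch[OF assms, of p] by (simp add: qfact_def[abs_def])

text \<open>The finite products decrease to their limit, which therefore bounds the denominators of
  \<open>qbinom\<close> from below, uniformly in the index.\<close>

lemma qpoch_self_le_qfact:
  assumes "0 < p" "p < 1"
  shows "qpoch p p \<le> qfact p n"
proof (rule LIMSEQ_le_const2[OF tendsto_qfact[OF assms]], intro exI allI impI)
  fix m assume "n \<le> m"
  have "qfact p (n + k) \<le> qfact p n" for k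
  proof (induction k)
    case (Suc k)
    have "qfact p (n + Suc k) = qfact p (n + k) * (1 - p ^ Suc (n + k))"
      by (simp add: qfact_def)
    also have "\<dots> \<le> qfact p (n + k)"
      using qfact_pos[OF assms, of "n + k"] assms
      by (intro mult_left_le) (auto simp: less_imp_le)
    finally show ?case using Suc by simp
  qed simp
  from this[of "m - n"] \<open>n \<le> m\<close> show "qfact p m \<le> qfact p n" by simp
qed

lemma qpoch_self_pos:
  assumes "0 < p" "p < 1"
  shows "qpoch p p > 0"
proof -
  have "p * p ^ n \<noteq> 1" for n
    using power_less_one_iff[of p "Suc n"] assms by auto
  then have "qpoch p p \<noteq> 0"
    using assms by (intro qpoch_nonzero) auto
  moreover have "qpoch p p \<ge> 0"
    using qfact_pos[OF assms] by (intro LIMSEQ_le_const[OF tendsto_qfact[OF assms]]) (auto intro: less_imp_le)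
  ultimately show ?thesis by simp
qed

text \<open>The bound is independent of \<open>n\<close> and \<open>j\<close>; it dominates the
  coefficients when the finite triple product passes to the limit.\<close>

lemma qbinom_bound:
  assumes "0 < p" "p < 1"
  shows "\<bar>qbinom p n j\<bar> \<le> 1 / (qpoch p p)\<^sup>2"
proof (cases "j \<le> n")
  case True
  have "\<bar>qbinom p n j\<bar> = qfact p n / (qfact p j * qfact p (n - j))"
    using True qfact_pos[OF assms] by (simp add: qbinom_def less_imp_le abs_mult)
  also have "\<dots> \<le> 1 / (qpoch p p * qpoch p p)"
    using qfact_le_1[OF assms] qpoch_self_le_qfact[OF assms] qpoch_self_pos[OF assms] qfact_pos[OF assms]
    by (intro frac_le mult_mono mult_pos_pos) (auto intro: less_imp_le)
  finally show ?thesis by (simp add: power2_eq_square)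
qed (simp add: qbinom_def)

text \<open>One of the two q-Pascal rules. It rests on \<open>1 - p ^ Suc n = (1 - p ^ (n - j)) + p
  ^ (n - j) * (1 - p ^ Suc j)\<close>.\<close>

lemma qbinom_Suc_Suc:
  assumes "0 < p" "p < 1" "j \<le> n"
  shows "qbinom p (Suc n) (Suc j) = qbinom p n (Suc j) + p ^ (n - j) * qbinom p n j"
proof (cases "j = n")
  case True
  then show ?thesis
    using qfact_pos[OF assms(1,2), of n] qfact_pos[OF assms(1,2), of "Suc n"]
    by (simp add: qbinom_def qfact_0)
next
  case False
  with assms obtain k where k: "n = Suc (j + k)"
    by (metis le_neq_implies_less less_iff_Suc_add)
  have nz: "qfact p j \<noteq> 0" "qfact p k \<noteq> 0" "1 - p ^ Suc j \<noteq> 0" "1 - p ^ Suc k \<noteq> 0"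
    using qfact_pos[OF assms(1,2), of j] qfact_pos[OF assms(1,2), of k] 
      power_less_one_iff[of p "Suc j"] power_less_one_iff[of p "Suc k"] assms by auto
  have Suc: "qfact p (Suc m) = qfact p m * (1 - p ^ Suc m)" for m
    by (simp add: qfact_def)
  have *: "F * (Y + y * X) / (a * X * (b * Y)) = F / (a * X * b) + y * (F / (a * (b * Y)))"
    if "a \<noteq> 0" "b \<noteq> 0" "X \<noteq> 0" "Y \<noteq> 0" for F X Y y a b :: real
    using that by (simp add: field_simps)
  have "1 - p ^ Suc n = (1 - p ^ Suc k) + p ^ Suc k * (1 - p ^ Suc j)"
    by (simp add: k power_add algebra_simps)
  then have "qbinom p (Suc n) (Suc j) = qfact p n * ((1 - p ^ Suc k) + p ^ Suc k * (1 - p ^ Suc j))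
      / (qfact p j * (1 - p ^ Suc j) * (qfact p k * (1 - p ^ Suc k)))"
    by (simp add: qbinom_def k Suc del: power_Suc)
  also have "\<dots> = qfact p n / (qfact p j * (1 - p ^ Suc j) * qfact p k)
      + p ^ Suc k * (qfact p n / (qfact p j * (qfact p k * (1 - p ^ Suc k))))"
    using nz by (rule * )
  also have "qfact p n / (qfact p j * (1 - p ^ Suc j) * qfact p k) = qbinom p n (Suc j)"
    by (simp add: qbinom_def k Suc del: power_Suc)
  also have "qfact p n / (qfact p j * (qfact p k * (1 - p ^ Suc k))) = qbinom p n j"
    by (simp add: qbinom_def k Suc Suc_diff_le del: power_Suc)
  finally show ?thesis by (simp add: k)
qed

lemma triangle_Suc: "Suc j * (Suc j - 1) div 2 = j * (j - 1) div 2 + j" for j :: nat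
proof -
  have "Suc j * (Suc j - 1) = j * (j - 1) + j * 2" by (cases j) auto
  then show ?thesis by (simp only: div_mult_self3)
qed

text \<open>In the induction step, the \<open>j\<close> gained by the triangular exponent and the
  \<open>n - j\<close> of Pascal's rule add up to the exponent of the new factor
  \<open>1 - w * p ^ n\<close>.\<close>

lemma qbinom_theorem:
  assumes "0 < p" "p < 1"
  shows "(\<Prod>i<n. 1 - w * p ^ i) = (\<Sum>j\<le>n. p ^ (j * (j - 1) div 2) * qbinom p n j * (- w) ^ j)"
proof (induction n)
  case 0
  then show ?case by (simp add: qbinom_def qfact_def)
next
  case (Suc n)
  define c where "c m j = p ^ (j * (j - 1) div 2) * qbinom p m j * (- w) ^ j" for m j
  have qb0: "qbinom p m 0 = 1" for m
    using qfact_pos[OF assms, of m] by (simp add: qbinom_def qfact_0)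
  have step: "c (Suc n) (Suc j) = c n (Suc j) - w * p ^ n * c n j" if "j \<le> n" for j
  proof -
    have "p ^ n = p ^ j * p ^ (n - j)"
      using that by (simp flip: power_add)
    then show ?thesis
      unfolding c_def triangle_Suc qbinom_Suc_Suc[OF assms that] by (simp add: power_add algebra_simps)
  qed
  have "(\<Sum>j\<le>Suc n. c (Suc n) j) = c (Suc n) 0 + (\<Sum>j\<le>n. c n (Suc j) - w * p ^ n * c n j)"
    unfolding sum.atMost_Suc_shift by (simp add: step)
  also have "\<dots> = (c n 0 + (\<Sum>j\<le>n. c n (Suc j))) - w * p ^ n * (\<Sum>j\<le>n. c n j)"
    by (simp add: sum_subtractf sum_distrib_left c_def qb0)
  also have "c n 0 + (\<Sum>j\<le>n. c n (Suc j)) = (\<Sum>j\<le>Suc n. c n j)"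
    unfolding sum.atMost_Suc_shift by simp
  also have "\<dots> = (\<Sum>j\<le>n. c n j)"
    by (simp add: c_def qbinom_def)
  finally show ?case
    using Suc by (simp add: c_def algebra_simps)
qed


section \<open>Two-sided theta series and the finite triple product\<close>

definition trinum :: "int \<Rightarrow> int" where
  "trinum n = n * (n - 1) div 2"

text \<open>The division by 2 is exact. Exponent identities are proved by doubling, which makes them
  polynomial.\<close>

lemma two_trinum: "2 * trinum n = n * (n - 1)"
  by (simp add: trinum_def)

lemma trinum_add: "trinum (m + n) = trinum m + trinum n + m * n"
  using two_trinum[of m] two_trinum[of n] two_trinum[of "m + n"] by (simp add: algebra_simps)

lemma trinum_of_nat: "int (j * (j - 1) div 2) = trinum (int j)"
  by (cases j) (simp_all add: trinum_def zdiv_int algebra_simps)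

definition tri :: "real \<Rightarrow> real \<Rightarrow> int \<Rightarrow> real" where
  "tri p z n = p powi trinum n * z powi n"

lemma summable_nat_tri:
  fixes p w :: real
  assumes "0 < p" "p < 1" "w > 0"
  shows "summable (\<lambda>n. p ^ (n * (n - 1) div 2) * w ^ n)"
proof -
  have "(\<lambda>n. p ^ n * w) \<longlonglongrightarrow> 0 * w"
    using assms by (intro tendsto_mult LIMSEQ_realpow_zero) auto
  then have "\<forall>\<^sub>F n in sequentially. p ^ n * w < 1 / 2"
    by (rule order_tendstoD) auto
  then obtain N where N: "\<And>n. n \<ge> N \<Longrightarrow> p ^ n * w < 1 / 2"
    by (auto simp: eventually_sequentially)
  show ?thesis
  proof (rule summable_ratio_test[where c = "1/2" and N = N])
    fix n assume "n \<ge> N"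
    have "p ^ (Suc n * (Suc n - 1) div 2) * w ^ Suc n = (p ^ n * w) * (p ^ (n * (n - 1) div 2) * w ^ n)"
      unfolding triangle_Suc by (simp add: power_add)
    also have "\<dots> \<le> 1 / 2 * (p ^ (n * (n - 1) div 2) * w ^ n)"
      using N[OF \<open>n \<ge> N\<close>] assms by (intro mult_right_mono) (auto intro: less_imp_le)
    finally show "norm (p ^ (Suc n * (Suc n - 1) div 2) * w ^ Suc n) \<le> 1 / 2 * norm (p ^ (n * (n - 1) div 2) * w ^ n)"
      using assms by simp
  qed simp
qed

lemma summable_on_int:
  fixes f :: "int \<Rightarrow> real"
  assumes "\<And>n. f n \<ge> 0" "summable (\<lambda>n. f (int n))" "summable (\<lambda>n. f (- int n))"
  shows "f summable_on UNIV"
proof -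
  have "f summable_on range int"
    using assms by (subst summable_on_reindex) (auto simp: o_def summable_on_UNIV_nonneg_real_iff)
  moreover have "f summable_on range (\<lambda>n. - int n)"
    using assms by (subst summable_on_reindex) (auto simp: o_def inj_on_def summable_on_UNIV_nonneg_real_iff)
  ultimately have "f summable_on (range int \<union> range (\<lambda>n. - int n))"
    by (rule summable_on_union)
  also have "range int \<union> range (\<lambda>n. - int n) = UNIV"
    by (auto simp: image_iff) (metis int_cases2)
  finally show ?thesis .
qed

text \<open>The negative half of the series is the positive half with \<open>z\<close> replaced by
  \<open>p / z\<close>, because \<open>trinum (- n) = trinum n + n\<close>.\<close>

lemma abs_summable_tri:
  assumes "0 < p" "p < 1" "z \<noteq> 0"
  shows "(\<lambda>n. \<bar>tri p z n\<bar>) summable_on UNIV"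
proof (rule summable_on_int)
  have "\<bar>tri p z (int n)\<bar> = p ^ (n * (n - 1) div 2) * \<bar>z\<bar> ^ n" for n
    using assms by (simp add: tri_def abs_mult power_abs flip: trinum_of_nat)
  then show "summable (\<lambda>n. \<bar>tri p z (int n)\<bar>)"
    using summable_nat_tri[of p "\<bar>z\<bar>"] assms by simp
  have "trinum (- int n) = trinum (int n) + int n" for n
    using two_trinum[of "- int n"] two_trinum[of "int n"] by (simp add: algebra_simps)
  then have "\<bar>tri p z (- int n)\<bar> = p ^ (n * (n - 1) div 2) * (p / \<bar>z\<bar>) ^ n" for n
    using assms
    by (simp add: tri_def abs_mult power_abs power_int_add power_int_minus power_divide divide_inverse
        power_mult_distrib power_inverse flip: trinum_of_nat)
  then show "summable (\<lambda>n. \<bar>tri p z (- int n)\<bar>)"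
    using summable_nat_tri[of p "p / \<bar>z\<bar>"] assms by simp
qed simp

text \<open>The q-binomial theorem is applied to \<open>2 * n\<close> factors with
  \<open>w = z / p ^ n\<close>, so that the exponents of \<open>p\<close> run from
  \<open>- n\<close> to \<open>n - 1\<close>. Turning over the factors with negative exponent yields
  the second product times the monomial \<open>C\<close>; the same monomial comes out of the sum
  when its index is centred at \<open>n\<close>.\<close>

lemma finite_jacobi_triple_product:
  assumes p: "0 < p" "p < 1" and z: "z \<noteq> 0"
  shows "(\<Prod>i<n. 1 - z * p ^ i) * (\<Prod>i<n. 1 - p / z * p ^ i) =
    (\<Sum>m\<in>{- int n..int n}. tri p (- z) m * qbinom p (2 * n) (nat (int n + m)))"
proof -
  define C where "C = (- z) powi int n * p powi (- (trinum (int n) + int n))"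
  have "(\<Prod>i<m. - z / p ^ Suc i) = (- z) powi int m * p powi (- (trinum (int m) + int m))" for m
  proof (induction m)
    case (Suc m)
    have "- (trinum (int (Suc m)) + int (Suc m)) = - (trinum (int m) + int m) + (- int (Suc m))"
      using trinum_add[of "int m" 1] by (simp add: trinum_def add_ac)
    then have "p powi (- (trinum (int (Suc m)) + int (Suc m))) = p powi (- (trinum (int m) + int m)) * p powi (- int (Suc m))"
      using p by (simp only:) (rule power_int_add, simp)
    moreover have "p powi (- int (Suc m)) = 1 / p ^ Suc m"
      unfolding power_int_minus power_int_of_nat by (simp add: divide_inverse)
    moreover have "(- z) powi int (Suc m) = (- z) powi int m * (- z)"
      unfolding power_int_of_nat by simp
    ultimately show ?case
      using Suc by simp
  qed (simp add: trinum_def)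
  note C = this[of n, folded C_def]
  have C0: "C \<noteq> 0"
    using p z by (simp add: C_def)
  have split: "(\<Prod>i<m + k. f i) = (\<Prod>i<m. f i) * (\<Prod>i<k. f (m + i))" for m k and f :: "nat \<Rightarrow> real"
    by (induction k) (simp_all add: mult_ac)
  have "(\<Prod>i<2 * n. 1 - z / p ^ n * p ^ i) = (\<Prod>i<n. 1 - z / p ^ n * p ^ i) * (\<Prod>i<n. 1 - z / p ^ n * p ^ (n + i))"
    unfolding mult_2 split ..
  also have "(\<Prod>i<n. 1 - z / p ^ n * p ^ (n + i)) = (\<Prod>i<n. 1 - z * p ^ i)"
    using p by (simp add: power_add)
  \<comment> \<open>In reversed order the exponents are -1, ..., \<open>- n\<close>, so factor
    \<open>i\<close> matches factor \<open>i\<close> of the second product.\<close>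
  also have "(\<Prod>i<n. 1 - z / p ^ n * p ^ i) = (\<Prod>i<n. 1 - z / p ^ n * p ^ (n - Suc i))"
    by (rule prod.nat_diff_reindex[symmetric])
  also have "\<dots> = (\<Prod>i<n. (- z / p ^ Suc i) * (1 - p / z * p ^ i))"
  proof (rule prod.cong)
    fix i assume "i \<in> {..<n}"
    then have "p ^ n = p ^ Suc i * p ^ (n - Suc i)"
      by (simp flip: power_add del: power_Suc)
    then have "z / p ^ n * p ^ (n - Suc i) = z / p ^ Suc i"
      using p by (simp del: power_Suc)
    then show "1 - z / p ^ n * p ^ (n - Suc i) = (- z / p ^ Suc i) * (1 - p / z * p ^ i)"
      using p z by (simp add: field_simps)
  qed simp
  also have "\<dots> = C * (\<Prod>i<n. 1 - p / z * p ^ i)"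
    unfolding prod.distrib C ..
  finally have lhs: "(\<Prod>i<2 * n. 1 - z / p ^ n * p ^ i) = C * ((\<Prod>i<n. 1 - z * p ^ i) * (\<Prod>i<n. 1 - p / z * p ^ i))"
    by (simp add: mult_ac)
  have "(\<Prod>i<2 * n. 1 - z / p ^ n * p ^ i) = (\<Sum>j\<le>2 * n. p ^ (j * (j - 1) div 2) * qbinom p (2 * n) j * (- (z / p ^ n)) ^ j)"
    by (rule qbinom_theorem[OF p])
  also have "\<dots> = (\<Sum>m\<in>{- int n..int n}. C * (tri p (- z) m * qbinom p (2 * n) (nat (int n + m))))"
  proof (rule sum.reindex_bij_witness[where i = "\<lambda>m. nat (int n + m)" and j = "\<lambda>j. int j - int n"])
    fix j assume "j \<in> {..2 * n}"
    define m where "m = int j - int n"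
    have j: "int j = int n + m" by (simp add: m_def)
    have "(- (z / p ^ n)) ^ j = (- z) ^ j * inverse (p ^ (n * j))"
      by (subst minus_divide_left) (simp only: divide_inverse power_mult_distrib power_mult power_inverse)
    moreover have "p powi (- (int n * int j)) = inverse (p ^ (n * j))"
      by (simp only: power_int_minus of_nat_mult[symmetric] power_int_of_nat)
    ultimately have "p ^ (j * (j - 1) div 2) * (- (z / p ^ n)) ^ j
        = p powi trinum (int j) * ((- z) powi int j * p powi (- (int n * int j)))"
      by (simp only: trinum_of_nat[symmetric] power_int_of_nat)
    also have "\<dots> = p powi (trinum (int n + m) + (- (int n * (int n + m)))) * (- z) powi (int n + m)"
      using p by (subst power_int_add) (simp_all add: j)
    \<comment> \<open>The cross term \<open>n * m\<close> cancels, which centres the quadratic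
      exponent at \<open>j = n\<close>.\<close>
    also have "trinum (int n + m) + (- (int n * (int n + m))) = trinum m + (- (trinum (int n) + int n))"
      using trinum_add[of "int n" m] two_trinum[of "int n"] by (simp add: algebra_simps)
    also have "p powi (trinum m + (- (trinum (int n) + int n))) * (- z) powi (int n + m) = C * tri p (- z) m"
      using p z by (subst power_int_add, simp)+ (simp add: C_def tri_def)
    finally show "C * (tri p (- z) (int j - int n) * qbinom p (2 * n) (nat (int n + (int j - int n)))) =
        p ^ (j * (j - 1) div 2) * qbinom p (2 * n) j * (- (z / p ^ n)) ^ j"
      by (simp add: m_def)
  qed auto
  finally show ?thesis
    unfolding lhs sum_distrib_left[symmetric] using C0 by simp
qed


text \<open>Tannery's argument: the finite identity passes to the limit term by term, because the
  coefficients around the centre tend to \<open>1 / qpoch p p\<close> and are uniformly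
  bounded.\<close>

theorem jacobi_triple_product:
  assumes p: "0 < p" "p < 1" and z: "z \<noteq> 0"
  shows "(tri p (- z) has_sum qpoch p p * theta p z) UNIV"
proof -
  define Q where "Q = qpoch p p"
  have Q: "Q > 0" using qpoch_self_pos[OF p] by (simp add: Q_def)
  \<comment> \<open>Extension by 0 outside the window puts all the finite sums over one index set,
    so that the M-test can be uniform in \<open>n\<close>.\<close>
  define f where "f m n = (if m \<in> {- int n..int n} then
    tri p (- z) m * qbinom p (2 * n) (nat (int n + m)) else 0)" for m n
  define P where "P n = (\<Prod>i<n. 1 - z * p ^ i) * (\<Prod>i<n. 1 - p / z * p ^ i)" for n
  have abs_summable: "(\<lambda>m. \<bar>tri p (- z) m\<bar>) summable_on UNIV"
    using abs_summable_tri[OF p, of "- z"] z by simp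
  then have summable: "tri p (- z) summable_on UNIV"
    using abs_summable_summable[of "tri p (- z)" UNIV] by simp
  have unif: "uniform_limit UNIV (\<lambda>X n. \<Sum>m\<in>X. f m n) P (finite_subsets_at_top UNIV)"
  proof (rule Weierstrass_m_test_general'[where M = "\<lambda>m. \<bar>tri p (- z) m\<bar> * (1 / Q\<^sup>2)"])
    show "norm (f m n) \<le> \<bar>tri p (- z) m\<bar> * (1 / Q\<^sup>2)" for m n
      unfolding f_def using mult_left_mono[OF qbinom_bound[OF p], of "\<bar>tri p (- z) m\<bar>"]
      by (auto simp: abs_mult Q_def)
    show "(\<lambda>m. \<bar>tri p (- z) m\<bar> * (1 / Q\<^sup>2)) summable_on UNIV"
      by (intro summable_on_cmult_left abs_summable)
    show "((\<lambda>m. f m n) has_sum P n) UNIV" for n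
    proof -
      have "P n = (\<Sum>m\<in>{- int n..int n}. f m n)"
        unfolding P_def finite_jacobi_triple_product[OF p z] by (intro sum.cong) (auto simp: f_def)
      then have "((\<lambda>m. f m n) has_sum P n) {- int n..int n}"
        by (simp add: has_sum_finite_iff)
      also have "?this \<longleftrightarrow> ?thesis"
        by (intro has_sum_cong_neutral) (auto simp: f_def)
      finally show ?thesis .
    qed
  qed
  have lim_qfact: "(\<lambda>n. qfact p (nat (int n + m))) \<longlonglongrightarrow> Q" for m
  proof -
    have "filterlim (\<lambda>n. nat (int n + m)) at_top sequentially"
      unfolding filterlim_at_top
    proof
      fix Z :: nat
      show "\<forall>\<^sub>F n in sequentially. Z \<le> nat (int n + m)"
        using eventually_ge_at_top[of "Z + nat \<bar>m\<bar>"] by eventually_elim linarith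
    qed
    from filterlim_compose[OF tendsto_qfact[OF p] this] show ?thesis
      by (simp add: Q_def)
  qed
  \<comment> \<open>All three arguments of \<open>qfact\<close> tend to infinity with
    \<open>n\<close>, which leaves \<open>Q / (Q * Q)\<close>.\<close>
  have lim: "f m \<longlonglongrightarrow> tri p (- z) m * (1 / Q)" for m
  proof -
    have "(\<lambda>n. qfact p (2 * n)) \<longlonglongrightarrow> Q"
      using LIMSEQ_subseq_LIMSEQ[OF tendsto_qfact[OF p], of "\<lambda>n. 2 * n"]
      by (simp add: o_def strict_mono_def Q_def)
    then have "(\<lambda>n. tri p (- z) m * (qfact p (2 * n) / (qfact p (nat (int n + m)) * qfact p (nat (int n + (- m))))))
        \<longlonglongrightarrow> tri p (- z) m * (Q / (Q * Q))"
      using Q by (intro tendsto_intros lim_qfact) auto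
    then have "(\<lambda>n. tri p (- z) m * (qfact p (2 * n) / (qfact p (nat (int n + m)) * qfact p (nat (int n + (- m))))))
        \<longlonglongrightarrow> tri p (- z) m * (1 / Q)"
      using Q by simp
    moreover have "\<forall>\<^sub>F n in sequentially. tri p (- z) m * (qfact p (2 * n) / (qfact p (nat (int n + m)) * qfact p (nat (int n + (- m))))) = f m n"
      using eventually_ge_at_top[of "nat \<bar>m\<bar>"]
    proof eventually_elim
      case (elim n)
      then have "2 * n - nat (int n + m) = nat (int n + (- m))" "nat (int n + m) \<le> 2 * n" "m \<in> {- int n..int n}"
        by auto
      then show ?case by (simp add: f_def qbinom_def)
    qed
    ultimately show ?thesis by (rule Lim_transform_eventually)
  qed
  define S where "S = infsum (tri p (- z)) UNIV"
  have S: "(tri p (- z) has_sum S) UNIV"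
    using summable by (simp add: S_def)
  have "P \<longlonglongrightarrow> S * (1 / Q)"
  proof (rule swap_uniform_limit'[OF _ _ unif])
    show "\<forall>\<^sub>F X in finite_subsets_at_top UNIV. (\<lambda>n. \<Sum>m\<in>X. f m n) \<longlonglongrightarrow> (\<Sum>m\<in>X. tri p (- z) m * (1 / Q))"
      by (intro always_eventually allI tendsto_sum lim)
    show "((\<lambda>X. \<Sum>m\<in>X. tri p (- z) m * (1 / Q)) \<longlongrightarrow> S * (1 / Q)) (finite_subsets_at_top UNIV)"
      using has_sum_cmult_left[OF S, of "1 / Q"] by (simp add: has_sum_def)
  qed auto
  moreover have "P \<longlonglongrightarrow> theta p z"
    unfolding P_def theta_def by (intro tendsto_mult tendsto_qpoch p)
  ultimately have "theta p z = S * (1 / Q)"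
    using LIMSEQ_unique by blast
  then show ?thesis
    using S Q by (simp add: Q_def)
qed

subsection \<open>The three-term relation\<close>

text \<open>Absolute summability of both factors makes the double series summable over the product
  set, so that it may be rearranged freely.\<close>

lemma has_sum_product:
  fixes f g :: "_ \<Rightarrow> real"
  assumes f: "(f has_sum a) A" "(\<lambda>x. \<bar>f x\<bar>) summable_on A"
    and g: "(g has_sum b) B" "(\<lambda>x. \<bar>g x\<bar>) summable_on B"
  shows "((\<lambda>(x, y). f x * g y) has_sum a * b) (A \<times> B)"
proof (rule has_sum_SigmaI)
  show "((\<lambda>y. case (x, y) of (x, y) \<Rightarrow> f x * g y) has_sum f x * b) B" for x
    using has_sum_cmult_right[OF g(1), of "f x"] by simp
  show "((\<lambda>x. f x * b) has_sum a * b) A"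
    by (rule has_sum_cmult_left[OF f(1)])
  have "(\<lambda>(x, y). \<bar>f x\<bar> * \<bar>g y\<bar>) summable_on A \<times> B"
  proof (rule summable_on_SigmaI)
    show "((\<lambda>y. case (x, y) of (x, y) \<Rightarrow> \<bar>f x\<bar> * \<bar>g y\<bar>) has_sum \<bar>f x\<bar> * infsum (\<lambda>y. \<bar>g y\<bar>) B) B" for x
      using has_sum_cmult_right[OF has_sum_infsum[OF g(2)], of "\<bar>f x\<bar>"] by simp
    show "(\<lambda>x. \<bar>f x\<bar> * infsum (\<lambda>y. \<bar>g y\<bar>) B) summable_on A"
      by (rule summable_on_cmult_left[OF f(2)])
  qed auto
  then show "(\<lambda>(x, y). f x * g y) summable_on A \<times> B"
    using abs_summable_summable[of "\<lambda>(x, y). f x * g y" "A \<times> B"]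
    by (simp add: case_prod_unfold abs_mult)
qed

lemma tri_shift:
  assumes "p \<noteq> 0" "z \<noteq> 0"
  shows "tri p z (k + 1) = z * tri p (p * z) k"
proof -
  have "trinum (k + 1) = trinum k + k"
    by (simp add: trinum_add trinum_def[of 1])
  then show ?thesis
    using assms by (simp add: tri_def power_int_add power_int_mult_distrib)
qed

text \<open>The parallelogram law makes the quadratic exponent diagonal in \<open>k\<close> and
  \<open>l\<close>, and the terms linear in \<open>l\<close> cancel. The extra \<open>p\<close>
  beside \<open>y\<^sup>2\<close> comes from \<open>l * l = 2 * trinum l + l\<close>.\<close>

lemma tri_mult_tri_even:
  assumes "p > 0" "x \<noteq> 0" "y \<noteq> 0"
  shows "tri p (- (x * y)) (k + l) * tri p (- (x / y)) (k - l) = tri (p\<^sup>2) (x\<^sup>2) k * tri (p\<^sup>2) (p * y\<^sup>2) l"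
proof -
  have sq: "(w\<^sup>2) powi j = w powi (2 * j)" for w :: real and j
    by (simp add: power_int_mult)
  have "trinum (k + l) + trinum (k - l) = 2 * trinum k + (2 * trinum l + l)"
    using two_trinum[of k] two_trinum[of l] two_trinum[of "k + l"] two_trinum[of "k - l"]
    by (simp add: algebra_simps)
  then have p: "p powi trinum (k + l) * p powi trinum (k - l) = p powi (2 * trinum k) * (p powi (2 * trinum l) * p powi l)"
    using assms by (simp flip: power_int_add)
  have x: "(- x) powi (k + l) * (- x) powi (k - l) = (x\<^sup>2) powi k"
    using assms sq[of "- x" k] by (simp flip: power_int_add)
  have "y powi (k + l) * (1 / y) powi (k - l) = y powi (k + l) * y powi (- (k - l))"
    by (simp only: power_int_minus inverse_eq_divide[symmetric] power_int_inverse)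
  also have "\<dots> = (y\<^sup>2) powi l"
    using assms by (simp add: sq flip: power_int_add)
  finally have y: "y powi (k + l) * (1 / y) powi (k - l) = (y\<^sup>2) powi l" .
  have "tri p (- (x * y)) (k + l) * tri p (- (x / y)) (k - l) = tri p ((- x) * y) (k + l) * tri p ((- x) * (1 / y)) (k - l)"
    by simp
  also have "\<dots> = (p powi trinum (k + l) * p powi trinum (k - l)) * ((- x) powi (k + l) * (- x) powi (k - l))
      * (y powi (k + l) * (1 / y) powi (k - l))"
    unfolding tri_def power_int_mult_distrib by (simp only: mult_ac)
  also have "\<dots> = tri (p\<^sup>2) (x\<^sup>2) k * tri (p\<^sup>2) (p * y\<^sup>2) l"
    unfolding p x y tri_def power_int_mult_distrib sq[of p] by (simp only: mult_ac)
  finally show ?thesis .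
qed

text \<open>Raising the first index of the even case by one costs
  \<open>- (x * y) * p powi (k + l)\<close>, whose power of \<open>p\<close> is absorbed into the
  two arguments.\<close>

lemma tri_mult_tri_odd:
  assumes "p > 0" "x \<noteq> 0" "y \<noteq> 0"
  shows "tri p (- (x * y)) (k + l + 1) * tri p (- (x / y)) (k - l)
    = - (x * y) * (tri (p\<^sup>2) (p * x\<^sup>2) k * tri (p\<^sup>2) (p\<^sup>2 * y\<^sup>2) l)"
proof -
  have scale: "tri q (c * z) j = c powi j * tri q z j" for q c z j
    by (simp add: tri_def power_int_mult_distrib mult_ac)
  have "p powi (k + l) = p powi k * p powi l"
    using assms by (simp add: power_int_add)
  then have "tri p (- (x * y)) (k + l + 1) * tri p (- (x / y)) (k - l)
    = - (x * y) * (p powi k * p powi l) * (tri p (- (x * y)) (k + l) * tri p (- (x / y)) (k - l))"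
    using assms tri_shift[of p "- (x * y)" "k + l"] scale[of p p "- (x * y)" "k + l"] by simp
  also have "\<dots> = - (x * y) * (p powi k * tri (p\<^sup>2) (x\<^sup>2) k) * (p powi l * tri (p\<^sup>2) (p * y\<^sup>2) l)"
    unfolding tri_mult_tri_even[OF assms] by (simp only: mult_ac)
  also have "\<dots> = - (x * y) * (tri (p\<^sup>2) (p * x\<^sup>2) k * tri (p\<^sup>2) (p * (p * y\<^sup>2)) l)"
    unfolding scale[symmetric] by (simp only: mult_ac)
  finally show ?thesis by (simp add: power2_eq_square mult_ac)
qed

text \<open>Written out, this is the sum of \<open>p powi (n * n) * x powi (2 * n)\<close>, Jacobi's
  theta_3 of nome \<open>p\<close>. The odd companion is the sum of
  \<open>p powi (n * n + n) * x powi (2 * n + 1)\<close>, which is theta_2 up to a fourth root of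
  \<open>p\<close>.\<close>

definition theta_even :: "real \<Rightarrow> real \<Rightarrow> real" where
  "theta_even p x = infsum (tri (p\<^sup>2) (p * x\<^sup>2)) UNIV"

definition theta_odd :: "real \<Rightarrow> real \<Rightarrow> real" where
  "theta_odd p x = x * infsum (tri (p\<^sup>2) (p\<^sup>2 * x\<^sup>2)) UNIV"

text \<open>Substituting \<open>m = k + l\<close>, \<open>n = k - l\<close> (or \<open>m = k + l + 1\<close>) separates the variables in the
  double series, so the product is a two-by-two determinant in \<open>x\<close> and \<open>y\<close>.\<close>

lemma theta_mult_theta:
  assumes p: "0 < p" "p < 1" and xy: "x \<noteq> 0" "y \<noteq> 0"
  shows "(qpoch p p)\<^sup>2 * (theta p (x * y) * theta p (x / y)) = x * (theta_odd p x * theta_even p y - theta_even p x * theta_odd p y)"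
proof -
  define f where "f = (\<lambda>(m, n). tri p (- (x * y)) m * tri p (- (x / y)) n)"
  have p2: "0 < p\<^sup>2" "p\<^sup>2 < 1"
    using p by (auto simp: power_less_one_iff abs_square_less_1)
  have abs_summable: "(\<lambda>n. \<bar>tri (p\<^sup>2) z n\<bar>) summable_on UNIV" if "z \<noteq> 0" for z
    by (rule abs_summable_tri[OF p2 that])
  have has_sum: "(tri (p\<^sup>2) z has_sum infsum (tri (p\<^sup>2) z) UNIV) UNIV" if "z \<noteq> 0" for z
    using abs_summable_summable[of "tri (p\<^sup>2) z"] abs_summable[OF that] by simp
  have "(f has_sum (qpoch p p * theta p (x * y)) * (qpoch p p * theta p (x / y))) (UNIV \<times> UNIV)"
    unfolding f_def using p xy
    by (intro has_sum_product jacobi_triple_product abs_summable_tri) auto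
  then have total: "(f has_sum (qpoch p p)\<^sup>2 * (theta p (x * y) * theta p (x / y))) UNIV"
    by (simp add: power2_eq_square mult_ac)
  have "((\<lambda>(k, l). tri (p\<^sup>2) (x\<^sup>2) k * tri (p\<^sup>2) (p * y\<^sup>2) l) has_sum infsum (tri (p\<^sup>2) (x\<^sup>2)) UNIV * theta_even p y) (UNIV \<times> UNIV)"
    unfolding theta_even_def using p xy by (intro has_sum_product has_sum abs_summable) auto
  also have "?this \<longleftrightarrow> (f has_sum infsum (tri (p\<^sup>2) (x\<^sup>2)) UNIV * theta_even p y) {(m, n). even (m + n)}"
  proof (rule has_sum_reindex_bij_witness[where j = "\<lambda>(k, l). (k + l, k - l)"
        and i = "\<lambda>(m, n). ((m + n) div 2, (m - n) div 2)"])
    have div: "(m + n) div 2 + (m - n) div 2 = m \<and> (m + n) div 2 - (m - n) div 2 = n" if "even (m + n)" for m n :: int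
      using that by presburger
    show "(case case b of (m, n) \<Rightarrow> ((m + n) div 2, (m - n) div 2) of (k, l) \<Rightarrow> (k + l, k - l)) = b"
      if "b \<in> {(m, n). even (m + n)}" for b :: "int \<times> int"
      using that div by (simp add: case_prod_unfold prod_eq_iff)
    show "(case a of (k, l) \<Rightarrow> (k + l, k - l)) \<in> {(m, n). even (m + n)}" for a :: "int \<times> int"
      by (simp add: case_prod_unfold)
    have "(k + l + (k - l)) div 2 = k" "(k + l - (k - l)) div 2 = l" for k l :: int
      by presburger+
    then show "(case case a of (k, l) \<Rightarrow> (k + l, k - l) of (m, n) \<Rightarrow> ((m + n) div 2, (m - n) div 2)) = a" for a :: "int \<times> int"
      by (simp only: case_prod_unfold fst_conv snd_conv prod.collapse)
  qed (use p xy in \<open>auto simp: f_def tri_mult_tri_even\<close>)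
  finally have even: "(f has_sum infsum (tri (p\<^sup>2) (x\<^sup>2)) UNIV * theta_even p y) {(m, n). even (m + n)}" .
  have "((\<lambda>(k, l). tri (p\<^sup>2) (p * x\<^sup>2) k * tri (p\<^sup>2) (p\<^sup>2 * y\<^sup>2) l) has_sum theta_even p x * infsum (tri (p\<^sup>2) (p\<^sup>2 * y\<^sup>2)) UNIV) (UNIV \<times> UNIV)"
    unfolding theta_even_def using p xy by (intro has_sum_product has_sum abs_summable) auto
  then have "((\<lambda>kl. - (x * y) * (case kl of (k, l) \<Rightarrow> tri (p\<^sup>2) (p * x\<^sup>2) k * tri (p\<^sup>2) (p\<^sup>2 * y\<^sup>2) l)) has_sum
     - (x * y) * (theta_even p x * infsum (tri (p\<^sup>2) (p\<^sup>2 * y\<^sup>2)) UNIV)) (UNIV \<times> UNIV)"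
    by (rule has_sum_cmult_right)
  also have "?this \<longleftrightarrow> (f has_sum - (x * y) * (theta_even p x * infsum (tri (p\<^sup>2) (p\<^sup>2 * y\<^sup>2)) UNIV)) {(m, n). odd (m + n)}"
  \<comment> \<open>The inverse of the even case serves again: \<open>m + n = 2 * k + 1\<close> and
    \<open>m - n = 2 * l + 1\<close>, and floor division drops the 1.\<close>
  proof (rule has_sum_reindex_bij_witness[where j = "\<lambda>(k, l). (k + l + 1, k - l)"
        and i = "\<lambda>(m, n). ((m + n) div 2, (m - n) div 2)"])
    have div: "(m + n) div 2 + (m - n) div 2 + 1 = m \<and> (m + n) div 2 - (m - n) div 2 = n" if "odd (m + n)" for m n :: int
      using that by presburger
    show "(case case b of (m, n) \<Rightarrow> ((m + n) div 2, (m - n) div 2) of (k, l) \<Rightarrow> (k + l + 1, k - l)) = b"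
      if "b \<in> {(m, n). odd (m + n)}" for b :: "int \<times> int"
      using that div by (simp add: case_prod_unfold prod_eq_iff)
    show "(case a of (k, l) \<Rightarrow> (k + l + 1, k - l)) \<in> {(m, n). odd (m + n)}" for a :: "int \<times> int"
      by (simp add: case_prod_unfold)
    have "(k + l + 1 + (k - l)) div 2 = k" "(k + l + 1 - (k - l)) div 2 = l" for k l :: int
      by presburger+
    then show "(case case a of (k, l) \<Rightarrow> (k + l + 1, k - l) of (m, n) \<Rightarrow> ((m + n) div 2, (m - n) div 2)) = a" for a :: "int \<times> int"
      by (simp only: case_prod_unfold fst_conv snd_conv prod.collapse)
  qed (use p xy in \<open>auto simp: f_def tri_mult_tri_odd\<close>)
  finally have odd: "(f has_sum - x * (theta_even p x * theta_odd p y)) {(m, n). odd (m + n)}"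
    by (simp add: theta_odd_def mult_ac)
  \<comment> \<open>Shifting the index by one turns the series with argument
    \<open>x\<^sup>2\<close> into the odd function, so that both terms are built from the same two
    functions.\<close>
  have "((\<lambda>k. tri (p\<^sup>2) (x\<^sup>2) (k + 1)) has_sum x * theta_odd p x) UNIV"
    using has_sum_cmult_right[OF has_sum[of "p\<^sup>2 * x\<^sup>2"], of "x\<^sup>2"] p xy
    by (simp add: tri_shift theta_odd_def power2_eq_square mult_ac)
  also have "?this \<longleftrightarrow> (tri (p\<^sup>2) (x\<^sup>2) has_sum x * theta_odd p x) UNIV"
    by (rule has_sum_reindex_bij_witness[where j = "\<lambda>k. k + 1" and i = "\<lambda>k. k - 1"]) auto
  finally have "infsum (tri (p\<^sup>2) (x\<^sup>2)) UNIV = x * theta_odd p x"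
    by (rule infsumI)
  with has_sum_Un_disjoint[OF even odd] have "(f has_sum x * (theta_odd p x * theta_even p y - theta_even p x * theta_odd p y)) ({(m, n). even (m + n)} \<union> {(m, n). odd (m + n)})"
    by (auto simp: algebra_simps)
  also have "{(m, n). even (m + n)} \<union> {(m, n). odd (m + n)} = (UNIV :: (int \<times> int) set)"
    by auto
  finally show ?thesis
    using total has_sum_unique by blast
qed

definition theta_pair :: "real \<Rightarrow> real \<Rightarrow> real \<Rightarrow> real" where
  "theta_pair p x y = theta p (x * y) * theta p (x / y) / x"

lemma theta_pair_minus_left: "theta_pair p (- x) y = - theta_pair p x (- y)"
  by (simp add: theta_pair_def)

theorem theta_pair_pluecker:
  assumes p: "0 < p" "p < 1" and "x \<noteq> 0" "y \<noteq> 0" "u \<noteq> 0" "v \<noteq> 0"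
  shows "theta_pair p x y * theta_pair p u v - theta_pair p x u * theta_pair p y v
    + theta_pair p x v * theta_pair p y u = 0"
proof -
  have pair: "theta_pair p a b = (theta_odd p a * theta_even p b - theta_even p a * theta_odd p b) / (qpoch p p)\<^sup>2"
    if "a \<noteq> 0" "b \<noteq> 0" for a b
    using theta_mult_theta[OF p that] qpoch_self_pos[OF p] that by (simp add: theta_pair_def field_simps)
  show ?thesis
    using assms qpoch_self_pos[OF p] by (simp add: pair field_simps)
qed

subsection \<open>Normalised theta functions\<close>

text \<open>The exponent is \<open>N/2\<close> times the second Bernoulli polynomial at \<open>x/N\<close>. It makes \<open>sigma\<close> odd and
  antiperiodic and removes all powers of \<open>q\<close> from the relations below.\<close>

definition sigma :: "real \<Rightarrow> real \<Rightarrow> real \<Rightarrow> real" where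
  "sigma q N x = q powr (x\<^sup>2 / (2 * N) - x / 2 + N / 12) * theta (q powr N) (q powr x)"

text \<open>Since \<open>q powr x\<close> is positive, negative arguments need a function of their
  own. With the same prefactor it is even and periodic.\<close>

definition sigma' :: "real \<Rightarrow> real \<Rightarrow> real \<Rightarrow> real" where
  "sigma' q N x = q powr (x\<^sup>2 / (2 * N) - x / 2 + N / 12) * theta (q powr N) (- (q powr x))"

context
  fixes q N :: real
  assumes q: "0 < q" "q < 1" and N: "0 < N"
begin

lemma nome: "0 < q powr N" "q powr N < 1"
  using q N powr_less_mono2[of N q 1] by auto

lemma exponent_minus: "q powr ((- x)\<^sup>2 / (2 * N) - (- x) / 2 + N / 12) * q powr (- x)
    = q powr (x\<^sup>2 / (2 * N) - x / 2 + N / 12)"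
  unfolding powr_add[symmetric] by (simp add: field_simps)

lemma sigma_minus: "sigma q N (- x) = - sigma q N x"
proof -
  have "theta (q powr N) (q powr (- x)) = - theta (q powr N) (q powr x) * q powr (- x)"
    using theta_inverse[OF nome, of "q powr x"] q by (simp add: powr_minus_divide)
  then show ?thesis
    unfolding sigma_def exponent_minus[of x, symmetric] by simp
qed

lemma sigma'_minus: "sigma' q N (- x) = sigma' q N x"
proof -
  have "theta (q powr N) (- (q powr (- x))) = theta (q powr N) (- (q powr x)) * q powr (- x)"
    using theta_inverse[OF nome, of "- (q powr x)"] q by (simp add: powr_minus_divide)
  then show ?thesis
    unfolding sigma'_def exponent_minus[of x, symmetric] by simp
qed

lemma exponent_shift: "q powr ((x + N)\<^sup>2 / (2 * N) - (x + N) / 2 + N / 12) * q powr (- x)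
      = q powr (x\<^sup>2 / (2 * N) - x / 2 + N / 12)"
proof -
  have "(x + N)\<^sup>2 / (2 * N) = x\<^sup>2 / (2 * N) + x + N / 2"
    using N by (simp add: power2_eq_square field_simps)
  then show ?thesis
    unfolding powr_add[symmetric] by (simp add: field_simps)
qed

lemma sigma_shift: "sigma q N (x + N) = - sigma q N x"
proof -
  have "theta (q powr N) (q powr (x + N)) = - theta (q powr N) (q powr x) * q powr (- x)"
    using theta_shift[OF nome, of "q powr x"] q by (simp add: powr_minus_divide powr_add mult_ac)
  then show ?thesis
    unfolding sigma_def exponent_shift[of x, symmetric] by simp
qed

lemma sigma'_shift: "sigma' q N (x + N) = sigma' q N x"
proof -
  have "theta (q powr N) (- (q powr (x + N))) = theta (q powr N) (- (q powr x)) * q powr (- x)"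
    using theta_shift[OF nome, of "- (q powr x)"] q by (simp add: powr_minus_divide powr_add mult_ac)
  then show ?thesis
    unfolding sigma'_def exponent_shift[of x, symmetric] by simp
qed

lemma sigma_period: "sigma q N (x + of_int j * (2 * N)) = sigma q N x"
proof -
  have step: "sigma q N (y + 2 * N) = sigma q N y" for y
    using sigma_shift[of y] sigma_shift[of "y + N"] by (simp add: add.assoc)
  show ?thesis
  proof (induction j rule: int_induct[where k = 0])
    case (step1 i)
    then show ?case using step[of "x + of_int i * (2 * N)"] by (simp add: algebra_simps)
  next
    case (step2 i)
    then show ?case using step[of "x + of_int (i - 1) * (2 * N)"] by (simp add: algebra_simps)
  qed simp
qed

lemma sigma'_period: "sigma' q N (x + of_int j * N) = sigma' q N x"
proof (induction j rule: int_induct[where k = 0])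
  case (step1 i)
  then show ?case using sigma'_shift[of "x + of_int i * N"] by (simp add: algebra_simps)
next
  case (step2 i)
  then show ?case using sigma'_shift[of "x + of_int (i - 1) * N"] by (simp add: algebra_simps)
qed simp

lemma sigma_nonzero:
  assumes "\<And>j :: int. x \<noteq> of_int j * N"
  shows "sigma q N x \<noteq> 0"
proof -
  have inj: "q powr a = q powr b \<longleftrightarrow> a = b" for a b
    using q by (simp add: powr_inj)
  have pow: "(q powr N) ^ n = q powr (real n * N)" for n
    using q by (simp add: powr_powr powr_realpow[symmetric] mult.commute)
  have "theta (q powr N) (q powr x) \<noteq> 0"
  proof (rule theta_nonzero[OF nome])
    show "q powr x * (q powr N) ^ n \<noteq> 1" for n
      using assms[of "- int n"] inj[of "x + real n * N" 0] q by (simp add: pow powr_add)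
    show "(q powr N) ^ Suc n \<noteq> q powr x" for n
      unfolding pow inj using assms[of "int (Suc n)"] by (simp del: of_nat_Suc)
  qed (use q in auto)
  then show ?thesis
    using q by (simp add: sigma_def)
qed

text \<open>By the parallelogram law the normalising exponents separate into a part in
  \<open>x\<close> and a part in \<open>y\<close>; the remaining \<open>1 / q powr x\<close> is the
  division built into \<open>theta_pair\<close>.\<close>

lemma exponent_pair:
  "q powr ((x + y)\<^sup>2 / (2 * N) - (x + y) / 2 + N / 12) * q powr ((x - y)\<^sup>2 / (2 * N) - (x - y) / 2 + N / 12)
   = q powr (N / 6) * (q powr (x\<^sup>2 / N) * q powr (y\<^sup>2 / N)) / q powr x"
proof -
  have collect: "a - (x + y) / 2 + N / 12 + (b - (x - y) / 2 + N / 12) = N / 6 + c - x"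
    if "a + b = c" for a b c
    unfolding that[symmetric] by (simp add: field_simps)
  have "(x + y)\<^sup>2 / (2 * N) + (x - y)\<^sup>2 / (2 * N) = x\<^sup>2 / N + y\<^sup>2 / N"
    using N by (simp add: power2_eq_square field_simps)
  then have "(x + y)\<^sup>2 / (2 * N) - (x + y) / 2 + N / 12 + ((x - y)\<^sup>2 / (2 * N) - (x - y) / 2 + N / 12)
      = N / 6 + (x\<^sup>2 / N + y\<^sup>2 / N) - x"
    by (rule collect)
  then show ?thesis
    by (simp only: powr_add[symmetric] powr_diff[symmetric])
qed

lemma sigma_mult_sigma:
  "sigma q N (x + y) * sigma q N (x - y) =
    q powr (N / 6) * (q powr (x\<^sup>2 / N) * q powr (y\<^sup>2 / N)) * theta_pair (q powr N) (q powr x) (q powr y)"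
proof -
  have "sigma q N (x + y) * sigma q N (x - y) =
     (q powr ((x + y)\<^sup>2 / (2 * N) - (x + y) / 2 + N / 12) * q powr ((x - y)\<^sup>2 / (2 * N) - (x - y) / 2 + N / 12))
     * (theta (q powr N) (q powr (x + y)) * theta (q powr N) (q powr (x - y)))"
    by (simp add: sigma_def mult_ac)
  then show ?thesis
    unfolding exponent_pair by (simp add: theta_pair_def powr_add powr_diff)
qed

lemma sigma'_mult_sigma':
  "sigma' q N (x + y) * sigma' q N (x - y) =
    q powr (N / 6) * (q powr (x\<^sup>2 / N) * q powr (y\<^sup>2 / N)) * theta_pair (q powr N) (q powr x) (- (q powr y))"
proof -
  have "sigma' q N (x + y) * sigma' q N (x - y) =
     (q powr ((x + y)\<^sup>2 / (2 * N) - (x + y) / 2 + N / 12) * q powr ((x - y)\<^sup>2 / (2 * N) - (x - y) / 2 + N / 12))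
     * (theta (q powr N) (- (q powr (x + y))) * theta (q powr N) (- (q powr (x - y))))"
    by (simp add: sigma'_def mult_ac)
  then show ?thesis
    unfolding exponent_pair by (simp add: theta_pair_def powr_add powr_diff)
qed

lemma weierstrass_sigma:
  "(sigma q N (x + y) * sigma q N (x - y)) * (sigma q N (u + v) * sigma q N (u - v))
   - (sigma q N (x + u) * sigma q N (x - u)) * (sigma q N (y + v) * sigma q N (y - v))
   + (sigma q N (x + v) * sigma q N (x - v)) * (sigma q N (y + u) * sigma q N (y - u)) = 0"
proof -
  define X Y U V where "X = q powr x" "Y = q powr y" "U = q powr u" "V = q powr v"
  have nz: "X \<noteq> 0" "Y \<noteq> 0" "U \<noteq> 0" "V \<noteq> 0" using q by (auto simp: X_Y_U_V_def)
  define D where "D = theta_pair (q powr N)"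
  \<comment> \<open>Each of the four parameters occurs exactly once in every term, so all three
    terms carry this factor.\<close>
  define C where "C = (q powr (N / 6))\<^sup>2 * q powr (x\<^sup>2 / N) * q powr (y\<^sup>2 / N) * q powr (u\<^sup>2 / N) * q powr (v\<^sup>2 / N)"
  have "D X Y * D U V - D X U * D Y V + D X V * D Y U = 0"
    unfolding D_def by (rule theta_pair_pluecker[OF nome nz])
  then have "C * (D X Y * D U V - D X U * D Y V + D X V * D Y U) = 0"
    by simp
  then show ?thesis
    unfolding sigma_mult_sigma D_def[symmetric] X_Y_U_V_def[symmetric] C_def
    by (simp add: algebra_simps power2_eq_square)
qed

text \<open>Negating only \<open>V\<close> in the Pluecker relation turns exactly the pairs
  containing \<open>v\<close> into \<open>sigma'\<close>.\<close>

lemma weierstrass_sigma_sigma':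
  "(sigma q N (x + y) * sigma q N (x - y)) * (sigma' q N (u + v) * sigma' q N (u - v))
   - (sigma q N (x + u) * sigma q N (x - u)) * (sigma' q N (y + v) * sigma' q N (y - v))
   + (sigma' q N (x + v) * sigma' q N (x - v)) * (sigma q N (y + u) * sigma q N (y - u)) = 0"
proof -
  define X Y U V where "X = q powr x" "Y = q powr y" "U = q powr u" "V = q powr v"
  have nz: "X \<noteq> 0" "Y \<noteq> 0" "U \<noteq> 0" "- V \<noteq> 0" using q by (auto simp: X_Y_U_V_def)
  define D where "D = theta_pair (q powr N)"
  define C where "C = (q powr (N / 6))\<^sup>2 * q powr (x\<^sup>2 / N) * q powr (y\<^sup>2 / N) * q powr (u\<^sup>2 / N) * q powr (v\<^sup>2 / N)"
  have "D X Y * D U (- V) - D X U * D Y (- V) + D X (- V) * D Y U = 0"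
    unfolding D_def by (rule theta_pair_pluecker[OF nome nz])
  then have "C * (D X Y * D U (- V) - D X U * D Y (- V) + D X (- V) * D Y U) = 0"
    by simp
  then show ?thesis
    unfolding sigma_mult_sigma sigma'_mult_sigma' D_def[symmetric] X_Y_U_V_def[symmetric] C_def
    by (simp add: algebra_simps power2_eq_square)
qed

text \<open>With \<open>U\<close> and \<open>V\<close> both negated, the pairs containing exactly
  one of them become \<open>sigma'\<close>, while the pair of \<open>U\<close> and \<open>V\<close>
  only changes its sign; hence the new signs.\<close>

lemma weierstrass_sigma':
  "(sigma q N (x + y) * sigma q N (x - y)) * (sigma q N (u + v) * sigma q N (u - v))
   + (sigma' q N (x + u) * sigma' q N (x - u)) * (sigma' q N (y + v) * sigma' q N (y - v))
   - (sigma' q N (x + v) * sigma' q N (x - v)) * (sigma' q N (y + u) * sigma' q N (y - u)) = 0"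
proof -
  define X Y U V where "X = q powr x" "Y = q powr y" "U = q powr u" "V = q powr v"
  have nz: "X \<noteq> 0" "Y \<noteq> 0" "- U \<noteq> 0" "- V \<noteq> 0" using q by (auto simp: X_Y_U_V_def)
  define D where "D = theta_pair (q powr N)"
  define C where "C = (q powr (N / 6))\<^sup>2 * q powr (x\<^sup>2 / N) * q powr (y\<^sup>2 / N) * q powr (u\<^sup>2 / N) * q powr (v\<^sup>2 / N)"
  have "D X Y * D (- U) (- V) - D X (- U) * D Y (- V) + D X (- V) * D Y (- U) = 0"
    unfolding D_def by (rule theta_pair_pluecker[OF nome nz])
  then have "C * (D X Y * D U V + D X (- U) * D Y (- V) - D X (- V) * D Y (- U)) = 0"
    by (simp add: D_def theta_pair_minus_left)
  then show ?thesis
    unfolding sigma_mult_sigma sigma'_mult_sigma' D_def[symmetric] X_Y_U_V_def[symmetric] C_def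
    by (simp add: algebra_simps power2_eq_square)
qed

lemma nome_double: "q powr (2 * N) = (q powr N)\<^sup>2"
  using q by (simp add: power2_eq_square flip: powr_add)

text \<open>On exponents this is the multiplication formula
  \<open>B y + B (y + 1/2) = B (2 * y) / 2\<close> of the second Bernoulli polynomial; it fixes the
  constant \<open>N / 12\<close> in \<open>sigma\<close>.\<close>

lemma sigma_split: "sigma q N x = sigma q (2 * N) x * sigma q (2 * N) (x + N)"
proof -
  have collect: "c - x / 2 + N / 12 = b - x / 2 + 2 * N / 12 + (a - (x + N) / 2 + 2 * N / 12)"
    if "a + b = c + x / 2 + N / 4" for a b c
    using that by (simp add: field_simps)
  have "(x + N)\<^sup>2 / (2 * (2 * N)) + x\<^sup>2 / (2 * (2 * N)) = x\<^sup>2 / (2 * N) + x / 2 + N / 4"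
    using N by (simp add: power2_eq_square field_simps)
  then have "x\<^sup>2 / (2 * N) - x / 2 + N / 12 = x\<^sup>2 / (2 * (2 * N)) - x / 2 + 2 * N / 12 +
     ((x + N)\<^sup>2 / (2 * (2 * N)) - (x + N) / 2 + 2 * N / 12)"
    by (rule collect)
  then show ?thesis
    unfolding sigma_def nome_double theta_split[OF nome]
    by (simp only: powr_add) (simp add: mult_ac)
qed

lemma sigma_mult_sigma'_double: "sigma q N x * sigma' q N x = sigma q (2 * N) (2 * x)"
proof -
  have "(2 * x)\<^sup>2 / (2 * (2 * N)) = x\<^sup>2 / (2 * N) + x\<^sup>2 / (2 * N)"
    using N by (simp add: power2_eq_square field_simps)
  then have "(2 * x)\<^sup>2 / (2 * (2 * N)) - 2 * x / 2 + 2 * N / 12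
      = (x\<^sup>2 / (2 * N) - x / 2 + N / 12) + (x\<^sup>2 / (2 * N) - x / 2 + N / 12)"
    by simp
  moreover have "q powr (2 * x) = (q powr x)\<^sup>2"
    using q by (simp add: power2_eq_square flip: powr_add)
  ultimately show ?thesis
    unfolding sigma_def sigma'_def nome_double
    by (simp only: powr_add theta_minus[OF nome, symmetric] mult_ac)
qed

end

subsection \<open>The identity for level 48\<close>

lemma sigma_reflect_24:
  assumes q: "0 < q" "q < 1" and k: "k mod 4 = (1 :: int)"
  shows "sigma q 24 (of_int k * 24 - x) = sigma q 24 x"
proof -
  define j where "j = k div 4"
  have j: "k = 1 + j * 4"
    using k div_mult_mod_eq[of k 4] unfolding j_def by linarith
  have "sigma q 24 (of_int k * 24 - x) = sigma q 24 ((- x + 24) + of_int (2 * j) * (2 * 24))"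
    by (simp add: j algebra_simps)
  also have "\<dots> = sigma q 24 (- x + 24)"
    by (rule sigma_period[OF q]) simp
  finally show ?thesis
    using sigma_shift[OF q, of 24 "- x"] sigma_minus[OF q, of 24 x] by simp
qed

text \<open>Because \<open>k mod 4 = 1\<close>, the number \<open>24 * k\<close> is congruent to 24
  modulo the period 96. Reflection about 24 then exchanges \<open>24 - x\<close> and
  \<open>x + 24\<close>.\<close>

lemma sigma_24_eq_sigma_48:
  assumes q: "0 < q" "q < 1" and k: "k mod 4 = (1 :: int)"
  shows "sigma q 24 x = sigma q 48 x * sigma q 48 (of_int k * 24 - x)"
proof -
  define j where "j = k div 4"
  have j: "k = 1 + j * 4"
    using k div_mult_mod_eq[of k 4] unfolding j_def by linarith
  have "sigma q 48 (of_int k * 24 - x) = sigma q 48 ((- x + 24) + of_int j * (2 * 48))"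
    by (simp add: j algebra_simps)
  also have "\<dots> = sigma q 48 (- x + 24)"
    by (rule sigma_period[OF q]) simp
  also have "\<dots> = sigma q 48 (x + 24)"
    using sigma_shift[OF q, of 48 "- x - 24"] sigma_minus[OF q, of 48 "x + 24"] by simp
  finally show ?thesis
    using sigma_split[OF q, of 24 x] by simp
qed

text \<open>Multiplying all arguments by \<open>k\<close> is a Galois conjugation; parts (i) to (iv) are the cases
  \<open>k = 1, 5, 17, 13\<close>.\<close>

theorem sigma_product_identity:
  fixes q :: real and k :: int
  assumes q: "0 < q" "q < 1" and k: "k mod 4 = 1" "coprime k 48"
  shows "1 / (\<Prod>a\<in>{1, 4, 7, 9, 10, 11, 12, 13, 14, 15, 17, 23}. sigma q 48 (of_int k * a))
    - 1 / (\<Prod>a\<in>{1, 3, 7, 8, 10, 11, 12, 13, 17, 21, 22, 23}. sigma q 48 (of_int k * a)) = 1"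
proof -
  define s where "s a = sigma q 48 (of_int k * a)" for a :: real
  define g where "g a = sigma q 24 (of_int k * a)" for a :: real
  define h where "h a = sigma' q 24 (of_int k * a)" for a :: real
  \<comment> \<open>Coprimality of \<open>k\<close> and 48 keeps the multiplied arguments away from
    the zeros of \<open>sigma\<close>.\<close>
  have nz: "s (of_int a) \<noteq> 0" if "\<not> 48 dvd a" for a :: int
    unfolding s_def
  proof (rule sigma_nonzero[OF q])
    fix j :: int
    have "\<not> 48 dvd k * a"
      using that k(2) by (simp add: coprime_dvd_mult_right_iff coprime_commute)
    then have "k * a \<noteq> j * 48"
      by (metis dvd_triv_right)
    then show "of_int k * of_int a \<noteq> of_int j * (48 :: real)"
      by (metis of_int_eq_iff of_int_mult of_int_numeral)
  qed simp
  have nz_num: "s (numeral a) \<noteq> 0" if "\<not> (48 :: int) dvd numeral a" for a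
    using nz[OF that] by simp
  have nz1: "s 1 \<noteq> 0"
    using nz[of 1] by simp
  note nz = nz1 nz_num
  have g: "g a = s a * s (24 - a)" for a
    unfolding g_def s_def using sigma_24_eq_sigma_48[OF q k(1), of "of_int k * a"] by (simp add: algebra_simps)
  have h: "g a * h a = s (2 * a)" for a
    unfolding g_def h_def s_def
    using sigma_mult_sigma'_double[OF q, of 24 "of_int k * a"] by (simp add: mult_ac)
  have h_eq: "h a = s (2 * a) / (s a * s (24 - a))" if "s a \<noteq> 0" "s (24 - a) \<noteq> 0" for a
    using h[of a] that by (simp add: g field_simps)
  have g_reflect: "g (24 - a) = g a" for a
    unfolding g_def using sigma_reflect_24[OF q k(1), of "of_int k * a"] by (simp add: algebra_simps)
  have g_minus: "g (- a) = - g a" and h_minus: "h (- a) = h a" and s_minus: "s (- a) = - s a" for a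
    unfolding g_def h_def s_def
    using sigma_minus[OF q, of 24 "of_int k * a"] sigma'_minus[OF q, of 24 "of_int k * a"]
      sigma_minus[OF q, of 48 "of_int k * a"] by simp_all
  have h_shift: "h (a + 24) = h a" for a
    unfolding h_def using sigma'_period[OF q, of 24 "of_int k * a" k] by (simp add: algebra_simps)
  \<comment> \<open>The parameters are half sums and half differences of the wanted arguments: 7/2
    and 5/2 give 1 and 6, 21/2 and 1/2 give 10 and 11. Periodicity and parity reduce 14 to 10 and
    -13 to 11.\<close>
  have W1: "g 1 * g 6 * g 10 * g 11 = h 3 * h 4 * h 8 * h 11 - h 2 * h 3 * h 7 * h 10"
  proof -
    have "(g 1 * g 6) * (g 10 * g 11) + (h 14 * h (- 7)) * (h (- 3) * h (- 2))
      - (h 3 * h 4) * (h 8 * h (- 13)) = 0"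
      unfolding g_def h_def
      using weierstrass_sigma'[OF q, of 24 "of_int k * (7/2)" "of_int k * (- 5/2)" "of_int k * (21/2)" "of_int k * (- 1/2)"]
      by (simp add: algebra_simps)
    then show ?thesis
      using h_shift[of "- 13"] h_shift[of "- 10"] by (simp add: h_minus algebra_simps)
  qed
  \<comment> \<open>Up to sign, 32, 21, 15, 14, 18 and 17 reduce to 8, 3, 9, 10, 6 and 7, by the
    period 24 of \<open>h\<close> and the reflection of \<open>g\<close> about 12.\<close>
  have W2: "g 3 * g 4 * h 3 * h 8 + g 3 * g 10 * h 9 * h 10 = h 6 * h 11 * g 6 * g 7"
  proof -
    have "(g 4 * g 3) * (h 32 * h 3) - (g 21 * g (- 14)) * (h 15 * h (- 14))
      + (h 18 * h (- 11)) * (g 18 * g (- 17)) = 0"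
      unfolding g_def h_def
      using weierstrass_sigma_sigma'[OF q, of 24 "of_int k * (7/2)" "of_int k * (1/2)" "of_int k * (35/2)" "of_int k * (29/2)"]
      by (simp add: algebra_simps)
    then show ?thesis
      using h_shift[of 8] h_shift[of "- 15"] h_shift[of "- 14"] h_shift[of "- 18"]
        g_reflect[of 3] g_reflect[of 10] g_reflect[of 6] g_reflect[of 7]
      by (simp add: h_minus g_minus algebra_simps)
  qed
  have W3: "s 4 * s 8 * s 12 * s 20 = s 2 * s 6 * s 10 * s 22 + s 2 * s 10 * s 14 * s 18"
  proof -
    have "(s 6 * s 2) * (s 10 * s (- 22)) - (s (- 2) * s 10) * (s 18 * s (- 14))
      + (s 20 * s (- 12)) * (s (- 4) * s 8) = 0"
      unfolding s_def
      using weierstrass_sigma[OF q, of 48 "of_int k * 4" "of_int k * 2" "of_int k * (- 6)" "of_int k * 16"]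
      by (simp add: algebra_simps)
    then show ?thesis
      by (simp add: s_minus algebra_simps)
  qed
  have g_val: "g 1 = s 1 * s 23"
    "g 3 = s 3 * s 21"
    "g 4 = s 4 * s 20"
    "g 6 = s 6 * s 18"
    "g 7 = s 7 * s 17"
    "g 10 = s 10 * s 14"
    "g 11 = s 11 * s 13"
    by (simp_all add: g)
  have h_val: "h 2 = s 4 / (s 2 * s 22)"
    "h 3 = s 6 / (s 3 * s 21)"
    "h 4 = s 8 / (s 4 * s 20)"
    "h 6 = s 12 / (s 6 * s 18)"
    "h 7 = s 14 / (s 7 * s 17)"
    "h 8 = s 16 / (s 8 * s 16)"
    "h 9 = s 18 / (s 9 * s 15)"
    "h 10 = s 20 / (s 10 * s 14)"
    "h 11 = s 22 / (s 11 * s 13)"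
    by (simp_all add: h_eq nz)
  \<comment> \<open>This is \<open>h 3\<close>, common to both terms on the right of
    \<open>W1\<close>; on the left, dividing by it trades \<open>s 6\<close> for
    \<open>s 3 * s 21\<close>.\<close>
  define c where "c = s 6 / (s 3 * s 21)"
  have e1: "g 1 * g 6 * g 10 * g 11 = c * (s 1 * s 23 * s 18 * s 10 * s 14 * s 11 * s 13 * s 3 * s 21)"
    unfolding g_val c_def by (simp add: nz)
  have e2: "h 3 * h 4 * h 8 * h 11 = c * (s 22 / (s 4 * s 20 * s 11 * s 13))"
    unfolding h_val c_def by (simp add: nz mult_ac)
  have e3: "h 2 * h 3 * h 7 * h 10 = c * (s 20 * s 4 / (s 10 * s 7 * s 17 * s 2 * s 22))"
    unfolding h_val c_def by (simp add: nz mult_ac)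
  have V1': "c * (s 1 * s 23 * s 18 * s 10 * s 14 * s 11 * s 13 * s 3 * s 21)
      = c * (s 22 / (s 4 * s 20 * s 11 * s 13) - s 20 * s 4 / (s 10 * s 7 * s 17 * s 2 * s 22))"
    using W1 unfolding e1 e2 e3 right_diff_distrib .
  have c0: "c \<noteq> 0"
    by (simp add: c_def nz)
  from V1' have V1: "s 1 * s 23 * s 18 * s 10 * s 14 * s 11 * s 13 * s 3 * s 21
      = s 22 / (s 4 * s 20 * s 11 * s 13) - s 20 * s 4 / (s 10 * s 7 * s 17 * s 2 * s 22)"
    by (rule mult_left_cancel[OF c0, THEN iffD1])
  have e4: "g 3 * g 4 * h 3 * h 8 = s 4 * s 20 * s 6 / s 8"
    unfolding g_val h_val by (simp add: nz)
  have e5: "g 3 * g 10 * h 9 * h 10 = s 3 * s 21 * s 18 * s 20 / (s 9 * s 15)"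
    unfolding g_val h_val by (simp add: nz)
  have e6: "h 6 * h 11 * g 6 * g 7 = s 12 * s 22 * s 7 * s 17 / (s 11 * s 13)"
    unfolding g_val h_val by (simp add: nz)
  have V2: "s 12 * s 22 * s 7 * s 17 / (s 11 * s 13) = s 4 * s 20 * s 6 / s 8 + s 3 * s 21 * s 18 * s 20 / (s 9 * s 15)"
    using W2[symmetric] unfolding e4 e5 e6 .
  \<comment> \<open>The left side is the product over the union of the two residue sets, the common
    denominator. The left side of \<open>V1\<close> divides it apart from the single surplus factor
    \<open>s 18\<close>.\<close>
  have "s 1 * s 3 * s 4 * s 7 * s 8 * s 9 * s 10 * s 11 * s 12 * s 13 * s 14 * s 15 * s 17 * s 21 * s 22 * s 23
      = (s 1 * s 23 * s 18 * s 10 * s 14 * s 11 * s 13 * s 3 * s 21) * (s 4 * s 7 * s 8 * s 9 * s 12 * s 15 * s 17 * s 22 / s 18)"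
    by (simp add: nz)
  also have "\<dots> = (s 12 * s 22 * s 7 * s 17 / (s 11 * s 13)) * (s 8 * s 9 * s 15 * s 22 / (s 18 * s 20))
      - (s 4 * s 8 * s 12 * s 20) * (s 4 * s 9 * s 15 / (s 18 * s 10 * s 2))"
    unfolding V1 by (simp add: nz field_simps)
  \<comment> \<open>\<open>V2\<close> and \<open>W3\<close> both contribute
    \<open>s 4 * s 6 * s 9 * s 15 * s 22 / s 18\<close>, which cancels. What remains are the
    products over the residues lying in only one of the two sets.\<close>
  also have "\<dots> = s 3 * s 8 * s 21 * s 22 - s 4 * s 9 * s 14 * s 15"
    unfolding V2 W3 by (simp add: nz field_simps)
  finally have main: "s 1 * s 3 * s 4 * s 7 * s 8 * s 9 * s 10 * s 11 * s 12 * s 13 * s 14 * s 15 * s 17 * s 21 * s 22 * s 23 = s 3 * s 8 * s 21 * s 22 - s 4 * s 9 * s 14 * s 15" .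
  have "1 / (s 1 * s 4 * s 7 * s 9 * s 10 * s 11 * s 12 * s 13 * s 14 * s 15 * s 17 * s 23) - 1 / (s 1 * s 3 * s 7 * s 8 * s 10 * s 11 * s 12 * s 13 * s 17 * s 21 * s 22 * s 23)
    = (s 3 * s 8 * s 21 * s 22 - s 4 * s 9 * s 14 * s 15) / (s 1 * s 3 * s 4 * s 7 * s 8 * s 9 * s 10 * s 11 * s 12 * s 13 * s 14 * s 15 * s 17 * s 21 * s 22 * s 23)"
    by (simp add: nz divide_simps)
  also have "\<dots> = 1"
    unfolding main[symmetric] by (simp add: nz)
  finally show ?thesis
    unfolding s_def[symmetric] by (simp add: mult_ac)
qed

subsection \<open>Generating functions of partitions\<close>

text \<open>Factors 1 outside \<open>S\<close> allow one infinite product for finite and infinite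
  sets alike; \<open>Suc n\<close> starts it at the part 1.\<close>

definition part_prod :: "nat set \<Rightarrow> real \<Rightarrow> real" where
  "part_prod S q = (\<Prod>n. if Suc n \<in> S then 1 - q ^ Suc n else 1)"

lemma convergent_prod_part_prod:
  fixes q :: real
  assumes "0 < q" "q < 1"
  shows "convergent_prod (\<lambda>n. if Suc n \<in> S then 1 - q ^ Suc n else 1)"
proof (rule abs_convergent_prod_imp_convergent_prod)
  have "summable (\<lambda>n. q * q ^ n)"
    using assms by (intro summable_mult summable_geometric) auto
  then have "summable (\<lambda>n. norm ((if Suc n \<in> S then 1 - q ^ Suc n else 1) - 1))"
    by (rule summable_comparison_test') (use assms in auto)
  then show "abs_convergent_prod (\<lambda>n. if Suc n \<in> S then 1 - q ^ Suc n else 1)"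
    by (simp add: abs_convergent_prod_conv_summable)
qed

lemma tendsto_part_prod:
  assumes "0 < q" "q < 1"
  shows "(\<lambda>n. \<Prod>i<n. if Suc i \<in> S then 1 - q ^ Suc i else 1) \<longlonglongrightarrow> part_prod S q"
  unfolding part_prod_def
  by (rule has_prod_imp_tendsto') (use convergent_prod_part_prod[OF assms] in auto)

lemma power_Suc_lt_1: "q ^ Suc n < 1" if "0 < q" "q < 1" for q :: real
  using that power_less_one_iff[of q "Suc n"] by auto

lemma part_prod_nonzero:
  assumes "0 < q" "q < 1"
  shows "part_prod S q \<noteq> 0"
  unfolding part_prod_def
  by (rule prodinf_nonzero[OF convergent_prod_part_prod[OF assms]])
    (use power_Suc_lt_1[OF assms] in \<open>auto simp: less_imp_neq\<close>)

lemma part_prod_Un: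
  assumes "0 < q" "q < 1" "A \<inter> B = {}"
  shows "part_prod (A \<union> B) q = part_prod A q * part_prod B q"
  unfolding part_prod_def prodinf_mult[OF convergent_prod_part_prod[OF assms(1,2)] convergent_prod_part_prod[OF assms(1,2)]]
  using assms(3) by (intro prodinf_cong) auto

text \<open>A partition either avoids \<open>s\<close> or arises by adding one copy of
  \<open>s\<close> to a smaller one.\<close>

lemma num_partitions_insert:
  assumes "0 \<notin> F" "s \<noteq> 0" "s \<notin> F"
  shows "num_partitions (insert s F) n =
    num_partitions F n + (if s \<le> n then num_partitions (insert s F) (n - s) else 0)"
proof -
  have fin: "finite (partitions_into (insert s F) m)" "finite (partitions_into F m)" for m
    using assms by (auto intro!: finite_partitions_into)
  have eq: "partitions_into (insert s F) n = partitions_into F n \<union>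
      (if s \<le> n then add_mset s ` partitions_into (insert s F) (n - s) else {})"
  proof (intro equalityI subsetI)
    fix P assume P: "P \<in> partitions_into (insert s F) n"
    show "P \<in> partitions_into F n \<union> (if s \<le> n then add_mset s ` partitions_into (insert s F) (n - s) else {})"
    proof (cases "s \<in># P")
      case True
      then obtain P' where "P = add_mset s P'" by (metis multi_member_split)
      then show ?thesis using P by (auto simp: partitions_into_def)
    next
      case False
      then show ?thesis using P by (auto simp: partitions_into_def)
    qed
  next
    fix P assume "P \<in> partitions_into F n \<union> (if s \<le> n then add_mset s ` partitions_into (insert s F) (n - s) else {})"
    then consider "P \<in> partitions_into F n"
      | P' where "s \<le> n" "P = add_mset s P'" "P' \<in> partitions_into (insert s F) (n - s)"
      by (cases "s \<le> n") auto
    then show "P \<in> partitions_into (insert s F) n"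
      by cases (auto simp: partitions_into_def)
  qed
  show ?thesis
  proof (cases "s \<le> n")
    case True
    have disj: "partitions_into F n \<inter> add_mset s ` partitions_into (insert s F) (n - s) = {}"
    proof (rule equals0I)
      fix P assume P: "P \<in> partitions_into F n \<inter> add_mset s ` partitions_into (insert s F) (n - s)"
      then have "s \<in># P" by fastforce
      moreover have "set_mset P \<subseteq> F"
        using P unfolding partitions_into_def by blast
      ultimately show False using assms(3) by blast
    qed
    have "card (partitions_into F n \<union> add_mset s ` partitions_into (insert s F) (n - s)) =
        card (partitions_into F n) + card (add_mset s ` partitions_into (insert s F) (n - s))"
      by (rule card_Un_disjoint[OF fin(2) finite_imageI[OF fin(1)] disj])
    also have "card (add_mset s ` partitions_into (insert s F) (n - s)) = card (partitions_into (insert s F) (n - s))"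
      by (rule card_image) (simp add: inj_on_def)
    finally show ?thesis
      unfolding num_partitions_def eq using True by (simp only: if_True)
  next
    case False
    then show ?thesis
      unfolding num_partitions_def eq by simp
  qed
qed

text \<open>Adjoining \<open>s\<close> gives \<open>A = B + q ^ s * A\<close> for the sums. That
  equation presupposes convergence of the new series, so its partial sums are first bounded by the
  truncated recursion.\<close>

lemma num_partitions_finite_sums:
  assumes q: "0 < q" "q < (1 :: real)" and "finite F" "0 \<notin> F"
  shows "(\<lambda>n. real (num_partitions F n) * q ^ n) sums (1 / (\<Prod>s\<in>F. 1 - q ^ s))"
  using assms(3,4)
proof (induction F rule: finite_induct)
  case empty
  have "partitions_into {} n = (if n = 0 then {{#}} else {})" for n
    by (auto simp: partitions_into_def)
  then have "(\<lambda>n. real (num_partitions {} n) * q ^ n) = (\<lambda>n. if n = 0 then 1 else 0)"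
    by (auto simp: num_partitions_def)
  then show ?case
    using sums_single[of 0 "\<lambda>_. 1 :: real"] by simp
next
  case (insert s F)
  define a where "a n = real (num_partitions (insert s F) n) * q ^ n" for n
  define b where "b n = real (num_partitions F n) * q ^ n" for n
  have s: "s > 0" and F: "0 \<notin> F" using insert by auto
  have b: "b sums (1 / (\<Prod>s\<in>F. 1 - q ^ s))"
    using insert by (simp add: b_def[abs_def])
  have qs: "q ^ s < 1"
    using q s power_Suc_lt_1[OF q, of "s - 1"] by simp
  have nonneg: "a n \<ge> 0" "b n \<ge> 0" for n
    using q by (auto simp: a_def b_def)
  have rec: "a n = b n + (if s \<le> n then q ^ s * a (n - s) else 0)" for n
  proof -
    have "q ^ n = q ^ s * q ^ (n - s)" if "s \<le> n"
      using that by (simp flip: power_add)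
    then show ?thesis
      unfolding a_def b_def num_partitions_insert[OF F _ insert.hyps(2), of n, OF gr_implies_not_zero[OF s]]
      by (auto simp: algebra_simps)
  qed
  have shift: "(\<Sum>n<M. if s \<le> n then q ^ s * a (n - s) else 0) \<le> q ^ s * (\<Sum>n<M. a n)" for M
  proof -
    have "(\<Sum>n<M. if s \<le> n then q ^ s * a (n - s) else 0) = (\<Sum>n\<in>{s..<M}. q ^ s * a (n - s))"
      by (rule sum.mono_neutral_cong_right) auto
    also have "\<dots> = (\<Sum>n<M - s. q ^ s * a n)"
      by (rule sum.reindex_bij_witness[where i = "\<lambda>n. n + s" and j = "\<lambda>n. n - s"]) auto
    also have "\<dots> \<le> (\<Sum>n<M. q ^ s * a n)"
      using q nonneg by (intro sum_mono2) auto
    finally show ?thesis by (simp add: sum_distrib_left)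
  qed
  have "(\<Sum>n<M. a n) \<le> (1 / (\<Prod>s\<in>F. 1 - q ^ s)) / (1 - q ^ s)" for M
  proof -
    have "(\<Sum>n<M. a n) = (\<Sum>n<M. b n) + (\<Sum>n<M. if s \<le> n then q ^ s * a (n - s) else 0)"
      by (simp add: sum.distrib[symmetric] rec[symmetric])
    also have "\<dots> \<le> 1 / (\<Prod>s\<in>F. 1 - q ^ s) + q ^ s * (\<Sum>n<M. a n)"
      using sum_le_suminf[OF sums_summable[OF b], of "{..<M}"] sums_unique[OF b] nonneg shift[of M]
      by (intro add_mono) auto
    finally have "(\<Sum>n<M. a n) * (1 - q ^ s) \<le> 1 / (\<Prod>s\<in>F. 1 - q ^ s)"
      by (simp add: algebra_simps)
    then show ?thesis
      using qs by (subst pos_le_divide_eq) auto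
  qed
  then have summable: "summable a"
    using nonneg by (intro summableI_nonneg_bounded) auto
  define A where "A = suminf a"
  have A: "a sums A" unfolding A_def using summable by (rule summable_sums)
  have "(\<lambda>n. if s \<le> n + s then q ^ s * a (n + s - s) else 0) sums (q ^ s * A)"
    using sums_mult[OF A, of "q ^ s"] by simp
  then have "(\<lambda>n. if s \<le> n then q ^ s * a (n - s) else 0) sums (q ^ s * A)"
    by (subst (asm) sums_iff_shift) simp
  from sums_add[OF b this] have "a sums (1 / (\<Prod>s\<in>F. 1 - q ^ s) + q ^ s * A)"
    by (simp add: rec[symmetric])
  with A have "A = 1 / (\<Prod>s\<in>F. 1 - q ^ s) + q ^ s * A"
    by (rule sums_unique2)
  then have "A * (1 - q ^ s) = 1 / (\<Prod>s\<in>F. 1 - q ^ s)"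
    by (simp add: algebra_simps)
  then have "A = 1 / (\<Prod>s\<in>F. 1 - q ^ s) / (1 - q ^ s)"
    using qs by (subst nonzero_eq_divide_eq) auto
  then have "A = 1 / (\<Prod>s\<in>insert s F. 1 - q ^ s)"
    using insert.hyps by (simp add: mult.commute)
  then show ?case
    using A by (simp add: a_def[abs_def])
qed

lemma num_partitions_mono:
  assumes "A \<subseteq> B" "0 \<notin> B"
  shows "num_partitions A n \<le> num_partitions B n"
  unfolding num_partitions_def
  using assms by (intro card_mono finite_partitions_into) (auto simp: partitions_into_def)

lemma num_partitions_restrict:
  assumes "n \<le> M"
  shows "num_partitions (S \<inter> {..M}) n = num_partitions S n"
proof -
  have "x \<le> sum_mset P" if "x \<in># P" for x and P :: "nat multiset"
    using that by (metis multi_member_split sum_mset.add_mset le_add1)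
  then have "partitions_into (S \<inter> {..M}) n = partitions_into S n"
    using assms by (fastforce simp: partitions_into_def)
  then show ?thesis by (simp add: num_partitions_def)
qed

text \<open>A squeeze: partial sums below \<open>M\<close> involve only parts up to \<open>M\<close>
  and stay below \<open>G M\<close>, while \<open>G M\<close> counts no more partitions than the
  full series does.\<close>

theorem num_partitions_sums:
  assumes q: "0 < q" "q < (1 :: real)" and S: "0 \<notin> S"
  shows "(\<lambda>n. real (num_partitions S n) * q ^ n) sums (1 / part_prod S q)"
proof -
  define a where "a n = real (num_partitions S n) * q ^ n" for n
  define G where "G M = 1 / (\<Prod>s\<in>S \<inter> {..M}. 1 - q ^ s)" for M
  have G_sums: "(\<lambda>n. real (num_partitions (S \<inter> {..M}) n) * q ^ n) sums G M" for M
    unfolding G_def using q S by (intro num_partitions_finite_sums) auto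
  have "(\<Prod>s\<in>S \<inter> {..M}. 1 - q ^ s) = (\<Prod>i<M. if Suc i \<in> S then 1 - q ^ Suc i else 1)" for M
  proof (induction M)
    case (Suc M)
    have "S \<inter> {..Suc M} = (if Suc M \<in> S then insert (Suc M) (S \<inter> {..M}) else S \<inter> {..M})"
      by (auto simp: le_Suc_eq)
    then show ?case using Suc by simp
  qed (use S in \<open>auto simp: Int_absorb1\<close>)
  then have G_lim: "G \<longlonglongrightarrow> 1 / part_prod S q"
    unfolding G_def
    by (simp only:) (intro tendsto_divide tendsto_const tendsto_part_prod[OF q] part_prod_nonzero[OF q])
  have le_G: "(\<Sum>n<M. a n) \<le> G M" for M
  proof -
    have "(\<Sum>n<M. a n) = (\<Sum>n<M. real (num_partitions (S \<inter> {..M}) n) * q ^ n)"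
      by (simp add: a_def num_partitions_restrict)
    also have "\<dots> \<le> G M"
      using sum_le_suminf[OF sums_summable[OF G_sums], of "{..<M}" M] sums_unique[OF G_sums, of M] q
      by simp
    finally show ?thesis .
  qed
  obtain K where K: "\<And>M. norm (G M) \<le> K"
    using G_lim by (metis Bseq_def convergentI convergent_imp_Bseq)
  have "summable a"
    by (rule summableI_nonneg_bounded[where x = K])
      (use q le_G K in \<open>auto simp: a_def intro: order_trans[OF _ order_trans[OF abs_ge_self]]\<close>)
  then have a: "a sums suminf a" by (rule summable_sums)
  have "suminf a \<le> 1 / part_prod S q"
    using a le_G unfolding sums_def by (intro LIMSEQ_le[OF _ G_lim]) auto
  moreover have "G M \<le> suminf a" for M
    by (rule sums_le[OF _ G_sums a])
      (use q S in \<open>auto simp: a_def intro!: mult_right_mono num_partitions_mono\<close>)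
  then have "1 / part_prod S q \<le> suminf a"
    by (intro LIMSEQ_le_const2[OF G_lim]) auto
  ultimately show ?thesis
    using a by (simp add: a_def[abs_def])
qed

text \<open>Only positive \<open>x\<close> are available, so the agreeing lower coefficients are
  removed, \<open>x ^ m\<close> is divided out, and \<open>x\<close> tends to 0 from the
  right.\<close>

lemma powser_unique:
  fixes f g :: "nat \<Rightarrow> real"
  assumes "\<And>x. 0 < x \<Longrightarrow> x < 1 \<Longrightarrow> (\<lambda>n. f n * x ^ n) sums F x"
    and "\<And>x. 0 < x \<Longrightarrow> x < 1 \<Longrightarrow> (\<lambda>n. g n * x ^ n) sums F x"
  shows "f n = g n"
proof (induction n rule: less_induct)
  case (less m)
  define d where "d n = f (n + m) - g (n + m)" for n
  have d_sums: "(\<lambda>n. d n * x ^ n) sums 0" if x: "0 < x" "x < 1" for x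
  proof -
    have "(\<lambda>n. (f n - g n) * x ^ n) sums 0"
      using sums_diff[OF assms(1)[OF x] assms(2)[OF x]] by (simp add: algebra_simps)
    then have "(\<lambda>n. (f (n + m) - g (n + m)) * x ^ (n + m)) sums 0"
      by (subst sums_iff_shift) (simp add: less)
    then have "(\<lambda>n. (f (n + m) - g (n + m)) * x ^ (n + m) / x ^ m) sums (0 / x ^ m)"
      by (rule sums_divide)
    then show ?thesis
      using x by (simp add: d_def power_add)
  qed
  \<comment> \<open>The limit theorem needs a full disc of convergence; a positive point
    \<open>y\<close> beyond the norm of \<open>x\<close> provides it.\<close>
  have "summable (\<lambda>n. d n * x ^ n)" if "norm x < 1" for x
  proof -
    from dense[OF that] obtain y where "norm x < y" "y < 1" by blast
    then show ?thesis
      using powser_inside[of d y x] sums_summable[OF d_sums[of y]] by auto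
  qed
  then have "((\<lambda>x. \<Sum>n. d n * x ^ n) \<longlongrightarrow> d 0) (at 0)"
    by (intro powser_limit_0[of 1]) auto
  then have "((\<lambda>x. \<Sum>n. d n * x ^ n) \<longlongrightarrow> d 0) (at_right 0)"
    by (rule filterlim_mono) (auto simp: at_within_le_at)
  moreover have "\<forall>\<^sub>F x in at_right 0. (\<Sum>n. d n * x ^ n) = 0"
    using eventually_at_right_less[of 0] eventually_at_right_real[of 0 1]
    by (auto elim!: eventually_mono simp: sums_iff dest!: d_sums)
  then have "((\<lambda>x. \<Sum>n. d n * x ^ n) \<longlongrightarrow> 0) (at_right 0)"
    by (rule tendsto_eventually)
  ultimately have "d 0 = 0"
    by (intro tendsto_unique[of "at_right (0 :: real)"]) auto
  then show ?case by (simp add: d_def)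
qed

text \<open>The monomial \<open>q ^ c\<close> marks the exceptional index: 0, below the range of
  \<open>n\<close>, in parts (i) to (iii), and the excluded value 2 in part (iv).\<close>

lemma num_partitions_identity:
  assumes "0 \<notin> S" "0 \<notin> T"
    and eq: "\<And>q. 0 < q \<Longrightarrow> q < 1 \<Longrightarrow> 1 / part_prod S q = q ^ b / part_prod T q + q ^ c"
  shows "num_partitions S n = (if b \<le> n then num_partitions T (n - b) else 0) + (if n = c then 1 else 0)"
proof -
  define g where "g n = (if b \<le> n then real (num_partitions T (n - b)) else 0) + (if n = c then 1 else 0)" for n
  have "real (num_partitions S n) = g n"
  proof (rule powser_unique)
    fix q :: real assume q: "0 < q" "q < 1"
    show "(\<lambda>n. real (num_partitions S n) * q ^ n) sums (q ^ b / part_prod T q + q ^ c)"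
      using num_partitions_sums[OF q assms(1)] eq[OF q] by simp
    have "(\<lambda>n. q ^ b * (real (num_partitions T n) * q ^ n)) sums (q ^ b * (1 / part_prod T q))"
      by (intro sums_mult num_partitions_sums[OF q assms(2)])
    then have "(\<lambda>n. (if b \<le> n + b then real (num_partitions T (n + b - b)) else 0) * q ^ (n + b)) sums (q ^ b / part_prod T q)"
      by (simp add: power_add mult_ac)
    then have "(\<lambda>n. (if b \<le> n then real (num_partitions T (n - b)) else 0) * q ^ n) sums (q ^ b / part_prod T q)"
      by (subst (asm) sums_iff_shift) simp
    from sums_add[OF this sums_single[of c "\<lambda>_. q ^ c"]]
    show "(\<lambda>n. g n * q ^ n) sums (q ^ b / part_prod T q + q ^ c)"
      by (rule sums_cong[THEN iffD1, rotated]) (auto simp: g_def algebra_simps)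
  qed
  then show ?thesis
    unfolding g_def by (auto simp flip: of_nat_eq_iff split: if_splits)
qed

section \<open>Residue classes modulo 48 as theta products\<close>

lemma pm_residues_insert: "pm_residues (insert r R) M = pm_residues {r} M \<union> pm_residues R M"
  by (auto simp: pm_residues_def)

lemma dvd_48_iff: "48 dvd x \<longleftrightarrow> x = 0" if "- 48 < x" "x < 48" for x :: int
  using that by (auto elim!: dvdE)

text \<open>Each block of 48 consecutive integers contributes one part congruent to \<open>m\<close>
  and one congruent to \<open>48 - m\<close>, distinct because \<open>m < 24\<close>; they feed the
  two products in \<open>theta\<close>.\<close>

lemma part_prod_pm_residues_single:
  assumes q: "0 < q" "q < 1" and r: "0 < r" "r < 24"
  shows "part_prod (pm_residues {r} 48) q = theta (q powr 48) (q powr of_int r)"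
proof (rule LIMSEQ_unique)
  define f where "f n = (if Suc n \<in> pm_residues {r} 48 then 1 - q ^ Suc n else 1)" for n
  define m where "m = nat r"
  have m: "r = int m" "0 < m" "m < 24" using r by (auto simp: m_def)
  have p: "0 < q ^ 48" "q ^ 48 < 1" using q by (auto simp: power_less_one_iff)
  \<comment> \<open>Index \<open>i\<close> stands for the part \<open>Suc i\<close>, hence
    \<open>m - 1\<close> and \<open>47 - m\<close>.\<close>
  have mem: "Suc (48 * M + i) \<in> pm_residues {r} 48 \<longleftrightarrow> i = m - 1 \<or> i = 47 - m" if "i < 48" for M i
  proof -
    have "Suc (48 * M + i) \<in> pm_residues {r} 48 \<longleftrightarrow>
        48 dvd (48 * int M + int i + 1 - int m) \<or> 48 dvd (48 * int M + int i + 1 + int m)"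
      by (simp add: pm_residues_def cong_iff_dvd_diff m(1) add_ac)
    also have "48 dvd (48 * int M + int i + 1 - int m) \<longleftrightarrow> 48 dvd (int i + 1 - int m)"
      using dvd_add_right_iff[of 48 "48 * int M" "int i + 1 - int m"] by (simp add: algebra_simps)
    also have "\<dots> \<longleftrightarrow> int i + 1 - int m = 0"
      using that m by (intro dvd_48_iff) auto
    also have "\<dots> \<longleftrightarrow> i = m - 1"
      using m by auto
    \<comment> \<open>Subtracting 48 brings the number into the range of
      \<open>dvd_48_iff\<close>.\<close>
    also have "48 dvd (48 * int M + int i + 1 + int m) \<longleftrightarrow> 48 dvd (int i + 1 + int m - 48)"
      using dvd_add_right_iff[of 48 "48 * int M + 48" "int i + 1 + int m - 48"] by (simp add: algebra_simps)
    also have "\<dots> \<longleftrightarrow> int i + 1 + int m - 48 = 0"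
      using that m by (intro dvd_48_iff) auto
    also have "\<dots> \<longleftrightarrow> i = 47 - m"
      using m by auto
    finally show ?thesis .
  qed
  have block: "(\<Prod>i<48. f (48 * M + i)) = (1 - q ^ m * (q ^ 48) ^ M) * (1 - q ^ (48 - m) * (q ^ 48) ^ M)" for M
  proof -
    have f: "f (48 * M + i) = 1 - q ^ Suc (48 * M + i)" if "i = m - 1 \<or> i = 47 - m" for i
    proof -
      have "i < 48" using that m(2,3) by auto
      then have "Suc (48 * M + i) \<in> pm_residues {r} 48"
        using that mem by blast
      then show ?thesis by (simp only: f_def if_True)
    qed
    have "(\<Prod>i<48. f (48 * M + i)) = (\<Prod>i\<in>{m - 1, 47 - m}. f (48 * M + i))"
      using m(2,3) by (intro prod.mono_neutral_right) (auto simp: f_def mem)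
    also have "\<dots> = f (48 * M + (m - 1)) * f (48 * M + (47 - m))"
      using m(2,3) by (subst prod.insert) auto
    also have "\<dots> = (1 - q ^ Suc (48 * M + (m - 1))) * (1 - q ^ Suc (48 * M + (47 - m)))"
      by (simp only: f simp_thms)
    also have "Suc (48 * M + (m - 1)) = m + 48 * M"
      using m(2,3) by auto
    also have "Suc (48 * M + (47 - m)) = (48 - m) + 48 * M"
      using m(2,3) by auto
    finally show ?thesis by (simp only: power_add power_mult)
  qed
  have split: "(\<Prod>i<a + b. f i) = (\<Prod>i<a. f i) * (\<Prod>i<b. f (a + i))" for a b
    by (induction b) (simp_all add: mult_ac)
  have prod: "(\<Prod>i<48 * M. f i) = (\<Prod>j<M. 1 - q ^ m * (q ^ 48) ^ j) * (\<Prod>j<M. 1 - q ^ (48 - m) * (q ^ 48) ^ j)" for M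
  proof (induction M)
    case (Suc M)
    have "(\<Prod>i<48 * Suc M. f i) = (\<Prod>i<48 * M. f i) * (\<Prod>i<48. f (48 * M + i))"
    proof -
      have "48 * Suc M = 48 * M + 48" by simp
      then show ?thesis by (simp only: split)
    qed
    then show ?case unfolding Suc block prod.lessThan_Suc by (simp only: mult_ac)
  qed simp
  have "strict_mono (\<lambda>n::nat. 48 * n)"
    by (auto simp: strict_mono_def)
  from LIMSEQ_subseq_LIMSEQ[OF tendsto_part_prod[OF q, of "pm_residues {r} 48"] this]
  show "(\<lambda>M. \<Prod>i<48 * M. f i) \<longlonglongrightarrow> part_prod (pm_residues {r} 48) q"
    by (simp add: o_def f_def)
  have "q powr 48 = q ^ 48"
    using q by simp
  moreover have "q powr of_int r = q ^ m"
    using q by (simp add: m(1) powr_realpow)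
  moreover have "q ^ (48 - m) = q ^ 48 / q ^ m"
    using q m by (intro power_diff) auto
  ultimately have "theta (q powr 48) (q powr of_int r) = qpoch (q ^ 48) (q ^ m) * qpoch (q ^ 48) (q ^ (48 - m))"
    by (simp add: theta_def)
  then show "(\<lambda>M. \<Prod>i<48 * M. f i) \<longlonglongrightarrow> theta (q powr 48) (q powr of_int r)"
    unfolding prod by (simp only:) (intro tendsto_mult tendsto_qpoch p)
qed

text \<open>Distinct residues from 1 to 23 stay distinct up to sign modulo 48, so their classes are
  disjoint. The exponent collects the normalisations of \<open>sigma\<close> for
  \<open>N = 48\<close>.\<close>

lemma part_prod_pm_residues:
  assumes q: "0 < q" "q < 1" and "finite R" "R \<subseteq> {1..23}"
  shows "(\<Prod>r\<in>R. sigma q 48 (of_int r)) = q powr (\<Sum>r\<in>R. (of_int r)\<^sup>2 / 96 - of_int r / 2 + 4) * part_prod (pm_residues R 48) q"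
  using assms(3,4)
proof (induction R rule: finite_induct)
  case empty
  have "pm_residues {} 48 = {}" by (simp add: pm_residues_def)
  then show ?case using q by (simp add: part_prod_def)
next
  case (insert r R)
  have "pm_residues {r} 48 \<inter> pm_residues R 48 = {}"
  proof (rule ccontr)
    assume "pm_residues {r} 48 \<inter> pm_residues R 48 \<noteq> {}"
    then obtain n t where t: "t \<in> R" "[int n = r] (mod 48) \<or> [int n = - r] (mod 48)" "[int n = t] (mod 48) \<or> [int n = - t] (mod 48)"
      by (auto simp: pm_residues_def)
    have bounds: "1 \<le> t" "t \<le> 23" "1 \<le> r" "r \<le> 23" "r \<noteq> t"
      using insert t(1) by auto
    have dvd: "48 dvd a - b" if "48 dvd int n - a" "48 dvd int n - b" for a b
      using dvd_diff[OF that(2,1)] by simp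
    have "48 dvd r - t \<or> 48 dvd r - (- t) \<or> 48 dvd - r - t \<or> 48 dvd - r - (- t)"
      using t(2,3) dvd unfolding cong_iff_dvd_diff by blast
    then show False
      using bounds dvd_48_iff[of "r - t"] dvd_48_iff[of "r - (- t)"] dvd_48_iff[of "- r - t"] dvd_48_iff[of "- r - (- t)"]
      by auto
  qed
  then have "part_prod (pm_residues (insert r R) 48) q = theta (q powr 48) (q powr of_int r) * part_prod (pm_residues R 48) q"
    using insert.prems unfolding pm_residues_insert[of r R]
    by (simp add: part_prod_Un[OF q] part_prod_pm_residues_single[OF q])
  then show ?case
    using insert by (simp add: sigma_def powr_add mult_ac)
qed

text \<open>With \<open>y\<close> between 0 and 24 the four forms cover all integers, so every
  multiplied residue returns to this range up to sign.\<close>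

lemma sigma_48_reduce:
  assumes q: "0 < q" "q < 1"
  shows "sigma q 48 (96 * of_int j + y) = sigma q 48 y"
    and "sigma q 48 (96 * of_int j + 48 - y) = sigma q 48 y"
    and "sigma q 48 (96 * of_int j + 48 + y) = - sigma q 48 y"
    and "sigma q 48 (96 * of_int j + 96 - y) = - sigma q 48 y"
proof -
  have period: "sigma q 48 (96 * of_int j + x) = sigma q 48 x" for x
    using sigma_period[OF q, of 48 x j] by (simp add: algebra_simps)
  show "sigma q 48 (96 * of_int j + y) = sigma q 48 y"
    by (rule period)
  show "sigma q 48 (96 * of_int j + 48 - y) = sigma q 48 y"
    using period[of "- y + 48"] sigma_shift[OF q, of 48 "- y"] sigma_minus[OF q, of 48 y] by (simp add: algebra_simps)
  show "sigma q 48 (96 * of_int j + 48 + y) = - sigma q 48 y"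
    using period[of "y + 48"] sigma_shift[OF q, of 48 y] by (simp add: algebra_simps)
  show "sigma q 48 (96 * of_int j + 96 - y) = - sigma q 48 y"
    using period[of "- y + 96"] sigma_period[OF q, of 48 "- y" 1] sigma_minus[OF q, of 48 y] by (simp add: algebra_simps)
qed

section \<open>The four generating function identities\<close>

lemma part_prod_identity_i:
  assumes q: "0 < q" "q < (1 :: real)"
  shows "1 / part_prod (pm_residues {1, 4, 7, 9, 10, 11, 12, 13, 14, 15, 17, 23} 48) q =
    q ^ 1 / part_prod (pm_residues {1, 3, 7, 8, 10, 11, 12, 13, 17, 21, 22, 23} 48) q + q ^ 0"
proof -
  let ?S = "part_prod (pm_residues {1, 4, 7, 9, 10, 11, 12, 13, 14, 15, 17, 23} 48) q"
  let ?T = "part_prod (pm_residues {1, 3, 7, 8, 10, 11, 12, 13, 17, 21, 22, 23} 48) q"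
  \<comment> \<open>Here and below the exponent of \<open>q\<close> is the evaluated sum from
    \<open>part_prod_pm_residues\<close>; the two values 0 and -1 produce the shift by 1.\<close>
  have "(\<Prod>r\<in>{1, 4, 7, 9, 10, 11, 12, 13, 14, 15, 17, 23}. sigma q 48 (of_int r)) = q powr (0) * ?S"
    by (subst part_prod_pm_residues[OF q]) (simp_all add: power2_eq_square)
  then have A: "(\<Prod>a\<in>{1, 4, 7, 9, 10, 11, 12, 13, 14, 15, 17, 23}. sigma q 48 (of_int 1 * a)) = (q powr (0) * ?S)"
    by (simp add: mult_ac)
  have "(\<Prod>r\<in>{1, 3, 7, 8, 10, 11, 12, 13, 17, 21, 22, 23}. sigma q 48 (of_int r)) = q powr (-1) * ?T"
    by (subst part_prod_pm_residues[OF q]) (simp_all add: power2_eq_square)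
  then have B: "(\<Prod>a\<in>{1, 3, 7, 8, 10, 11, 12, 13, 17, 21, 22, 23}. sigma q 48 (of_int 1 * a)) = (q powr (-1) * ?T)"
    by (simp add: mult_ac)
  have "?S \<noteq> 0" "?T \<noteq> 0"
    using part_prod_nonzero[OF q] by auto
  then show ?thesis
    using sigma_product_identity[OF q, of 1] q unfolding A B
    by (simp add: powr_minus_divide field_simps)
qed

text \<open>Multiplication by 5 causes an odd number of sign changes in each product. Both
  reciprocals change sign, so the two sets exchange roles: the first product becomes that of
  \<open>?T\<close>.\<close>

lemma part_prod_identity_ii:
  assumes q: "0 < q" "q < (1 :: real)"
  shows "1 / part_prod (pm_residues {2, 5, 7, 8, 9, 11, 12, 13, 14, 15, 17, 19} 48) q =
    q ^ 2 / part_prod (pm_residues {2, 3, 5, 7, 11, 12, 13, 17, 19, 20, 21, 22} 48) q + q ^ 0"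
proof -
  let ?S = "part_prod (pm_residues {2, 5, 7, 8, 9, 11, 12, 13, 14, 15, 17, 19} 48) q"
  let ?T = "part_prod (pm_residues {2, 3, 5, 7, 11, 12, 13, 17, 19, 20, 21, 22} 48) q"
  have red: "sigma q 48 35 = sigma q 48 13"
    "sigma q 48 40 = sigma q 48 8"
    "sigma q 48 45 = sigma q 48 3"
    "sigma q 48 50 = - sigma q 48 2"
    "sigma q 48 55 = - sigma q 48 7"
    "sigma q 48 60 = - sigma q 48 12"
    "sigma q 48 65 = - sigma q 48 17"
    "sigma q 48 70 = - sigma q 48 22"
    "sigma q 48 75 = - sigma q 48 21"
    "sigma q 48 85 = - sigma q 48 11"
    "sigma q 48 105 = sigma q 48 9"
    "sigma q 48 110 = sigma q 48 14"
    "sigma q 48 115 = sigma q 48 19"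
    using sigma_48_reduce(2)[OF q, of 0 13] sigma_48_reduce(2)[OF q, of 0 8] sigma_48_reduce(2)[OF q, of 0 3] sigma_48_reduce(3)[OF q, of 0 2] sigma_48_reduce(3)[OF q, of 0 7] sigma_48_reduce(3)[OF q, of 0 12] sigma_48_reduce(3)[OF q, of 0 17] sigma_48_reduce(3)[OF q, of 0 22] sigma_48_reduce(4)[OF q, of 0 21] sigma_48_reduce(4)[OF q, of 0 11] sigma_48_reduce(1)[OF q, of 1 9] sigma_48_reduce(1)[OF q, of 1 14] sigma_48_reduce(1)[OF q, of 1 19] by simp_all
  have "(\<Prod>r\<in>{2, 3, 5, 7, 11, 12, 13, 17, 19, 20, 21, 22}. sigma q 48 (of_int r)) = q powr (-2) * ?T"
    by (subst part_prod_pm_residues[OF q]) (simp_all add: power2_eq_square)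
  then have A: "(\<Prod>a\<in>{1, 4, 7, 9, 10, 11, 12, 13, 14, 15, 17, 23}. sigma q 48 (of_int 5 * a)) = - (q powr (-2) * ?T)"
    by (simp add: red mult_ac)
  have "(\<Prod>r\<in>{2, 5, 7, 8, 9, 11, 12, 13, 14, 15, 17, 19}. sigma q 48 (of_int r)) = q powr (0) * ?S"
    by (subst part_prod_pm_residues[OF q]) (simp_all add: power2_eq_square)
  then have B: "(\<Prod>a\<in>{1, 3, 7, 8, 10, 11, 12, 13, 17, 21, 22, 23}. sigma q 48 (of_int 5 * a)) = - (q powr (0) * ?S)"
    by (simp add: red mult_ac)
  have "?S \<noteq> 0" "?T \<noteq> 0"
    using part_prod_nonzero[OF q] by auto
  then show ?thesis
    using sigma_product_identity[OF q, of 5] q unfolding A B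
    by (simp add: coprime_iff_gcd_eq_1 gcd_non_0_int powr_minus_divide field_simps)
qed

text \<open>Multiplication by 17 also negates both products and exchanges the roles; the exponents
  -1 and 0 leave a shift by 1.\<close>

lemma part_prod_identity_iii:
  assumes q: "0 < q" "q < (1 :: real)"
  shows "1 / part_prod (pm_residues {1, 3, 5, 7, 8, 10, 12, 17, 19, 21, 22, 23} 48) q =
    q ^ 1 / part_prod (pm_residues {1, 2, 5, 7, 9, 12, 15, 17, 19, 20, 22, 23} 48) q + q ^ 0"
proof -
  let ?S = "part_prod (pm_residues {1, 3, 5, 7, 8, 10, 12, 17, 19, 21, 22, 23} 48) q"
  let ?T = "part_prod (pm_residues {1, 2, 5, 7, 9, 12, 15, 17, 19, 20, 22, 23} 48) q"
  have red: "sigma q 48 51 = - sigma q 48 3"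
    "sigma q 48 68 = - sigma q 48 20"
    "sigma q 48 119 = sigma q 48 23"
    "sigma q 48 136 = sigma q 48 8"
    "sigma q 48 153 = - sigma q 48 9"
    "sigma q 48 170 = - sigma q 48 22"
    "sigma q 48 187 = - sigma q 48 5"
    "sigma q 48 204 = sigma q 48 12"
    "sigma q 48 221 = sigma q 48 19"
    "sigma q 48 238 = sigma q 48 2"
    "sigma q 48 255 = - sigma q 48 15"
    "sigma q 48 289 = sigma q 48 1"
    "sigma q 48 357 = - sigma q 48 21"
    "sigma q 48 374 = - sigma q 48 10"
    "sigma q 48 391 = sigma q 48 7"
    using sigma_48_reduce(3)[OF q, of 0 3] sigma_48_reduce(3)[OF q, of 0 20] sigma_48_reduce(1)[OF q, of 1 23] sigma_48_reduce(2)[OF q, of 1 8] sigma_48_reduce(3)[OF q, of 1 9] sigma_48_reduce(4)[OF q, of 1 22] sigma_48_reduce(4)[OF q, of 1 5] sigma_48_reduce(1)[OF q, of 2 12] sigma_48_reduce(2)[OF q, of 2 19] sigma_48_reduce(2)[OF q, of 2 2] sigma_48_reduce(3)[OF q, of 2 15] sigma_48_reduce(1)[OF q, of 3 1] sigma_48_reduce(3)[OF q, of 3 21] sigma_48_reduce(4)[OF q, of 3 10] sigma_48_reduce(1)[OF q, of 4 7] by simp_all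
  have "(\<Prod>r\<in>{1, 2, 5, 7, 9, 12, 15, 17, 19, 20, 22, 23}. sigma q 48 (of_int r)) = q powr (-1) * ?T"
    by (subst part_prod_pm_residues[OF q]) (simp_all add: power2_eq_square)
  then have A: "(\<Prod>a\<in>{1, 4, 7, 9, 10, 11, 12, 13, 14, 15, 17, 23}. sigma q 48 (of_int 17 * a)) = - (q powr (-1) * ?T)"
    by (simp add: red mult_ac)
  have "(\<Prod>r\<in>{1, 3, 5, 7, 8, 10, 12, 17, 19, 21, 22, 23}. sigma q 48 (of_int r)) = q powr (0) * ?S"
    by (subst part_prod_pm_residues[OF q]) (simp_all add: power2_eq_square)
  then have B: "(\<Prod>a\<in>{1, 3, 7, 8, 10, 11, 12, 13, 17, 21, 22, 23}. sigma q 48 (of_int 17 * a)) = - (q powr (0) * ?S)"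
    by (simp add: red mult_ac)
  have "?S \<noteq> 0" "?T \<noteq> 0"
    using part_prod_nonzero[OF q] by auto
  then show ?thesis
    using sigma_product_identity[OF q, of 17] q unfolding A B
    by (simp add: coprime_iff_gcd_eq_1 gcd_non_0_int powr_minus_divide field_simps)
qed

text \<open>Multiplication by 13 again exchanges the roles, but both normalising exponents are 2. No
  shift remains, and the constant 1 becomes \<open>q ^ 2\<close>, the source of the exception at
  2.\<close>

lemma part_prod_identity_iv:
  assumes q: "0 < q" "q < (1 :: real)"
  shows "1 / part_prod (pm_residues {1, 2, 5, 8, 9, 11, 12, 13, 14, 15, 19, 23} 48) q =
    q ^ 0 / part_prod (pm_residues {1, 3, 4, 5, 10, 11, 12, 13, 14, 19, 21, 23} 48) q + q ^ 2"
proof -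
  let ?S = "part_prod (pm_residues {1, 2, 5, 8, 9, 11, 12, 13, 14, 15, 19, 23} 48) q"
  let ?T = "part_prod (pm_residues {1, 3, 4, 5, 10, 11, 12, 13, 14, 19, 21, 23} 48) q"
  have red: "sigma q 48 39 = sigma q 48 9"
    "sigma q 48 52 = - sigma q 48 4"
    "sigma q 48 91 = - sigma q 48 5"
    "sigma q 48 104 = sigma q 48 8"
    "sigma q 48 117 = sigma q 48 21"
    "sigma q 48 130 = sigma q 48 14"
    "sigma q 48 143 = sigma q 48 1"
    "sigma q 48 156 = - sigma q 48 12"
    "sigma q 48 169 = - sigma q 48 23"
    "sigma q 48 182 = - sigma q 48 10"
    "sigma q 48 195 = sigma q 48 3"
    "sigma q 48 221 = sigma q 48 19"
    "sigma q 48 273 = - sigma q 48 15"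
    "sigma q 48 286 = - sigma q 48 2"
    "sigma q 48 299 = sigma q 48 11"
    using sigma_48_reduce(2)[OF q, of 0 9] sigma_48_reduce(3)[OF q, of 0 4] sigma_48_reduce(4)[OF q, of 0 5] sigma_48_reduce(1)[OF q, of 1 8] sigma_48_reduce(1)[OF q, of 1 21] sigma_48_reduce(2)[OF q, of 1 14] sigma_48_reduce(2)[OF q, of 1 1] sigma_48_reduce(3)[OF q, of 1 12] sigma_48_reduce(4)[OF q, of 1 23] sigma_48_reduce(4)[OF q, of 1 10] sigma_48_reduce(1)[OF q, of 2 3] sigma_48_reduce(2)[OF q, of 2 19] sigma_48_reduce(4)[OF q, of 2 15] sigma_48_reduce(4)[OF q, of 2 2] sigma_48_reduce(1)[OF q, of 3 11] by simp_all
  have "(\<Prod>r\<in>{1, 3, 4, 5, 10, 11, 12, 13, 14, 19, 21, 23}. sigma q 48 (of_int r)) = q powr (2) * ?T"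
    by (subst part_prod_pm_residues[OF q]) (simp_all add: power2_eq_square)
  then have A: "(\<Prod>a\<in>{1, 4, 7, 9, 10, 11, 12, 13, 14, 15, 17, 23}. sigma q 48 (of_int 13 * a)) = - (q powr (2) * ?T)"
    by (simp add: red mult_ac)
  have "(\<Prod>r\<in>{1, 2, 5, 8, 9, 11, 12, 13, 14, 15, 19, 23}. sigma q 48 (of_int r)) = q powr (2) * ?S"
    by (subst part_prod_pm_residues[OF q]) (simp_all add: power2_eq_square)
  then have B: "(\<Prod>a\<in>{1, 3, 7, 8, 10, 11, 12, 13, 17, 21, 22, 23}. sigma q 48 (of_int 13 * a)) = - (q powr (2) * ?S)"
    by (simp add: red mult_ac)
  have "?S \<noteq> 0" "?T \<noteq> 0"
    using part_prod_nonzero[OF q] by auto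
  then show ?thesis
    using sigma_product_identity[OF q, of 13] q unfolding A B
    by (simp add: coprime_iff_gcd_eq_1 gcd_non_0_int powr_minus_divide field_simps)
qed

theorem theorem7p6:
  shows
    "(\<forall>n\<ge>1. num_partitions (pm_residues {1, 4, 7, 9, 10, 11, 12, 13, 14, 15, 17, 23} 48) n =
            num_partitions (pm_residues {1, 3, 7, 8, 10, 11, 12, 13, 17, 21, 22, 23} 48) (n - 1)) \<and>
     (\<forall>n\<ge>2. num_partitions (pm_residues {2, 5, 7, 8, 9, 11, 12, 13, 14, 15, 17, 19} 48) n =
            num_partitions (pm_residues {2, 3, 5, 7, 11, 12, 13, 17, 19, 20, 21, 22} 48) (n - 2)) \<and>
     (\<forall>n\<ge>1. num_partitions (pm_residues {1, 3, 5, 7, 8, 10, 12, 17, 19, 21, 22, 23} 48) n =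
            num_partitions (pm_residues {1, 2, 5, 7, 9, 12, 15, 17, 19, 20, 22, 23} 48) (n - 1)) \<and>
     (\<forall>n. n \<noteq> 2 \<longrightarrow>
            num_partitions (pm_residues {1, 2, 5, 8, 9, 11, 12, 13, 14, 15, 19, 23} 48) n =
            num_partitions (pm_residues {1, 3, 4, 5, 10, 11, 12, 13, 14, 19, 21, 23} 48) n)"
  using num_partitions_identity[OF zero_notin_pm_residues zero_notin_pm_residues part_prod_identity_i]
    num_partitions_identity[OF zero_notin_pm_residues zero_notin_pm_residues part_prod_identity_ii]
    num_partitions_identity[OF zero_notin_pm_residues zero_notin_pm_residues part_prod_identity_iii]
    num_partitions_identity[OF zero_notin_pm_residues zero_notin_pm_residues part_prod_identity_iv]
  by simp

end
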